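(* Let $(Z,d_Z)$ and $(W,d_W)$ be quasisymmetrically equivalent, compact, Ahlfors regular metric spaces. Let $X=(V_X,E_X)$ and $Y=(V_Y,E_Y)$ be hyperbolic fillings of $Z$ and $W$, respectively. Then $V_X$ and $V_Y$, with the metrics restricted from the graph metrics on $X$ and $Y$, are bilipschitz equivalent.
   Context: Ahlfors regular: a metric space $(Z,d)$ is Ahlfors $Q$-regular ($Q>0$) if, for $\mu$ the Hausdorff $Q$-measure induced by $d$, there are constants $c,C>0$ such that $c r^Q\le\mu(B(x,r))\le C r^Q$ for all $x\in Z$ and all $0<r\le\operatorname{diam}(Z)$. It is Ahlfors regular if it is Ahlfors $Q$-regular for some $Q$. (The exponents for $Z$ and $W$ may differ.) Quasisymmetry: a homeomorphism $f\colon(X,d_X)\to(Y,d_Y)$ between metric spaces is a quasisymmetry if there is a homeomorphism $\eta\colon[0,\infty)\to[0,\infty)$ such that for all $x,y,z\in X$ with $x\ne z$ $$\frac{d_Y(f(x),f(y))}{d_Y(f(x),f(z))}\le\eta\left(\frac{d_X(x,y)}{d_X(x,z)}\right).$$ Two metric spaces are quasisymmetrically equivalent if there is a quasisymmetry from one onto the other. Hyperbolic filling: let $(Z,d)$ be a compact metric space; rescale the metric by a positive constant so that $\operatorname{diam}(Z)<1$, and fix a parameter $s>1$. For each integer $k\ge0$ choose a maximal $s^{-k}$-separated set $P_k\subseteq Z$ (distinct points of $P_k$ are at distance at least $s^{-k}$, and $P_k$ is maximal under inclusion with this property). The vertex set is $V=\{(k,p): k\ge0,\ p\in P_k\}$;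 to $v=(k,p)$ associate its level $\ell(v)=k$ and the ball $B_v=B(p,2s^{-k})\subseteq Z$. Two distinct vertices $v,w$ are joined by an edge if and only if $|\ell(v)-\ell(w)|\le1$ and $B_v\cap B_w\neq\emptyset$. Any (connected) graph $(V,E)$ obtained in this way is a hyperbolic filling of $Z$. The parameters and choices for $X$ and $Y$ are independent of each other. Graph metric: each edge is isometric to an interval of length $1$; the distance between two vertices is the fewest number of edges required to connect them. Bilipschitz equivalence: a bijection $g\colon (A,d_A)\to(B,d_B)$ between metric spaces for which there is $C>0$ with $\frac1C d_A(x,x')\le d_B(g(x),g(x'))\le C d_A(x,x')$ for all $x,x'\in A$. Two spaces are bilipschitz equivalent if such a bijection exists. *)

theory Defs
  imports "HOL-Analysis.Analysis"
begin

section \<open>Metric notions\<close>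

text \<open>The extended diameter: \<open>0\<close> on the empty set, and \<open>\<infinity>\<close> on unbounded sets (where a
  supremum taken in the reals would be unspecified).\<close>

definition mdiameter :: "'a metric \<Rightarrow> 'a set \<Rightarrow> ennreal" where
  "mdiameter m S = (SUP x\<in>S. SUP y\<in>S. ennreal (mdist m x y))"

definition scaled_metric :: "real \<Rightarrow> 'a metric \<Rightarrow> 'a metric" where
  "scaled_metric c m = metric (mspace m, \<lambda>x y. c * mdist m x y)"

lemma Metric_space_scaled:
  assumes "c > 0"
  shows "Metric_space (mspace m) (\<lambda>x y. c * mdist m x y)"
proof
  fix x y z
  assume "x \<in> mspace m" "y \<in> mspace m" "z \<in> mspace m"
  then have "c * mdist m x z \<le> c * (mdist m x y + mdist m y z)"
    using assms by (intro mult_left_mono mdist_triangle) auto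
  then show "c * mdist m x z \<le> c * mdist m x y + c * mdist m y z"
    by (simp add: algebra_simps)
qed (use assms in \<open>auto simp: mdist_commute\<close>)

lemma
  assumes "c > 0"
  shows mspace_scaled_metric [simp]: "mspace (scaled_metric c m) = mspace m"
    and mdist_scaled_metric [simp]: "mdist (scaled_metric c m) x y = c * mdist m x y"
  unfolding scaled_metric_def
  by (simp_all only: Metric_space.mspace_metric[OF Metric_space_scaled[OF assms]]
      Metric_space.mdist_metric[OF Metric_space_scaled[OF assms]])

definition bilipschitz_equivalent :: "'a metric \<Rightarrow> 'b metric \<Rightarrow> bool" where
  "bilipschitz_equivalent A B \<longleftrightarrow>
    (\<exists>g C. bij_betw g (mspace A) (mspace B) \<and> C > 0 \<and>
      (\<forall>x\<in>mspace A. \<forall>x'\<in>mspace A.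
         1 / C * mdist A x x' \<le> mdist B (g x) (g x') \<and>
         mdist B (g x) (g x') \<le> C * mdist A x x'))"


section \<open>Quasisymmetries\<close>

definition quasisymmetry :: "'a metric \<Rightarrow> 'b metric \<Rightarrow> ('a \<Rightarrow> 'b) \<Rightarrow> bool" where
  "quasisymmetry X Y f \<longleftrightarrow>
    homeomorphic_map (mtopology_of X) (mtopology_of Y) f \<and>
    (\<exists>\<eta>::real \<Rightarrow> real.
      homeomorphic_map (top_of_set {0..}) (top_of_set {0..}) \<eta> \<and>
      (\<forall>x\<in>mspace X. \<forall>y\<in>mspace X. \<forall>z\<in>mspace X. x \<noteq> z \<longrightarrow>
        mdist Y (f x) (f y) / mdist Y (f x) (f z) \<le> \<eta> (mdist X x y / mdist X x z)))"

definition quasisymmetrically_equivalent :: "'a metric \<Rightarrow> 'b metric \<Rightarrow> bool" where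
  "quasisymmetrically_equivalent X Y \<longleftrightarrow>
    (\<exists>f. quasisymmetry X Y f) \<or> (\<exists>g. quasisymmetry Y X g)"


section \<open>Hausdorff measure and Ahlfors regularity\<close>

text \<open>The Hausdorff measure is given as an outer measure, without a normalising constant: such a
  constant is absorbed by the two constants in Ahlfors regularity. Coverings are indexed by
  \<open>nat\<close>; finite ones are included by padding with \<open>{}\<close>, which contributes \<open>0 powr Q = 0\<close>. The use of
  \<^const>\<open>enn2real\<close> is harmless, as the covering sets have diameter at most \<open>\<delta> < \<infinity>\<close>.\<close>

definition hausdorff_content :: "'a metric \<Rightarrow> real \<Rightarrow> real \<Rightarrow> 'a set \<Rightarrow> ennreal" where
  "hausdorff_content m Q \<delta> A =
    (INF U \<in> {U :: nat \<Rightarrow> 'a set.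
        (\<forall>i. U i \<subseteq> mspace m \<and> mdiameter m (U i) \<le> ennreal \<delta>) \<and> A \<subseteq> (\<Union>i. U i)}.
      \<Sum>i. ennreal (enn2real (mdiameter m (U i)) powr Q))"

definition hausdorff_measure :: "'a metric \<Rightarrow> real \<Rightarrow> 'a set \<Rightarrow> ennreal" where
  "hausdorff_measure m Q A = (SUP \<delta>\<in>{0<..}. hausdorff_content m Q \<delta> A)"

definition ahlfors_regular_dim :: "'a metric \<Rightarrow> real \<Rightarrow> bool" where
  "ahlfors_regular_dim m Q \<longleftrightarrow> Q > 0 \<and>
    (\<exists>c C. c > 0 \<and> C > 0 \<and>
      (\<forall>x\<in>mspace m. \<forall>r. 0 < r \<and> ennreal r \<le> mdiameter m (mspace m) \<longrightarrow>
        ennreal (c * r powr Q) \<le> hausdorff_measure m Q (mball_of m x r) \<and>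
        hausdorff_measure m Q (mball_of m x r) \<le> ennreal (C * r powr Q)))"

definition ahlfors_regular :: "'a metric \<Rightarrow> bool" where
  "ahlfors_regular m \<longleftrightarrow> (\<exists>Q. ahlfors_regular_dim m Q)"


section \<open>Graph metrics\<close>

text \<open>The edges of a simple graph are two-element sets of vertices. A walk with \<open>n\<close> edges from \<open>v\<close>
  to \<open>w\<close> witnesses that \<open>(v, w)\<close> lies in the \<open>n\<close>-th power of the adjacency relation.\<close>

definition adjacency :: "'v set set \<Rightarrow> 'v rel" where
  "adjacency E = {(v, w). {v, w} \<in> E}"

definition graph_connected :: "'v set \<Rightarrow> 'v set set \<Rightarrow> bool" where
  "graph_connected V E \<longleftrightarrow> (\<forall>v\<in>V. \<forall>w\<in>V. (v, w) \<in> (adjacency E)\<^sup>*)"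

definition graph_dist :: "'v set set \<Rightarrow> 'v \<Rightarrow> 'v \<Rightarrow> nat" where
  "graph_dist E v w = (LEAST n. (v, w) \<in> adjacency E ^^ n)"

text \<open>The path metric restricted to the vertices; meaningful for connected graphs.\<close>

definition graph_metric :: "'v set \<Rightarrow> 'v set set \<Rightarrow> 'v metric" where
  "graph_metric V E = metric (V, \<lambda>v w. real (graph_dist E v w))"

lemma adjacency_relpow_sym: "(v, w) \<in> adjacency E ^^ n \<Longrightarrow> (w, v) \<in> adjacency E ^^ n"
proof (induction n arbitrary: w)
  case (Suc n)
  then obtain u where u: "(v, u) \<in> adjacency E ^^ n" "(u, w) \<in> adjacency E"
    by auto
  then have "(w, u) \<in> adjacency E"
    by (simp add: adjacency_def insert_commute)
  with Suc.IH[OF u(1)] show ?case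
    by (meson relpow_Suc_I2)
qed simp

lemma graph_dist_relpow:
  assumes "graph_connected V E" "v \<in> V" "w \<in> V"
  shows "(v, w) \<in> adjacency E ^^ graph_dist E v w"
proof -
  have "\<exists>n. (v, w) \<in> adjacency E ^^ n"
    using assms by (auto simp: graph_connected_def rtrancl_power)
  then show ?thesis
    unfolding graph_dist_def by (rule LeastI_ex)
qed

lemma Metric_space_graph_dist:
  assumes "graph_connected V E"
  shows "Metric_space V (\<lambda>v w. real (graph_dist E v w))"
proof
  fix v w
  have "(v, w) \<in> adjacency E ^^ n \<longleftrightarrow> (w, v) \<in> adjacency E ^^ n" for n
    using adjacency_relpow_sym by metis
  then show "real (graph_dist E v w) = real (graph_dist E w v)"
    by (simp add: graph_dist_def)
next
  fix v w assume vw: "v \<in> V" "w \<in> V"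
  have "v = w" if "graph_dist E v w = 0"
    using graph_dist_relpow[OF assms vw] that by simp
  moreover have "graph_dist E v v = 0"
    unfolding graph_dist_def by (rule Least_eq_0) simp
  ultimately show "real (graph_dist E v w) = 0 \<longleftrightarrow> v = w"
    by auto
next
  fix u v w assume uvw: "u \<in> V" "v \<in> V" "w \<in> V"
  have "(u, w) \<in> adjacency E ^^ (graph_dist E u v + graph_dist E v w)"
    using graph_dist_relpow[OF assms uvw(1,2)] graph_dist_relpow[OF assms uvw(2,3)]
    by (auto simp: relpow_add)
  then have "graph_dist E u w \<le> graph_dist E u v + graph_dist E v w"
    unfolding graph_dist_def[of E u w] by (rule Least_le)
  then show "real (graph_dist E u w) \<le> real (graph_dist E u v) + real (graph_dist E v w)"
    by linarith
qed simp

lemma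
  assumes "graph_connected V E"
  shows mspace_graph_metric: "mspace (graph_metric V E) = V"
    and mdist_graph_metric: "mdist (graph_metric V E) v w = real (graph_dist E v w)"
  using Metric_space.mspace_metric[OF Metric_space_graph_dist[OF assms]]
    Metric_space.mdist_metric[OF Metric_space_graph_dist[OF assms]]
  by (simp_all add: graph_metric_def)


section \<open>Hyperbolic fillings\<close>

definition separated_set :: "'a metric \<Rightarrow> real \<Rightarrow> 'a set \<Rightarrow> bool" where
  "separated_set m \<epsilon> P \<longleftrightarrow>
    P \<subseteq> mspace m \<and> (\<forall>p\<in>P. \<forall>q\<in>P. p \<noteq> q \<longrightarrow> \<epsilon> \<le> mdist m p q)"

definition maximal_separated_set :: "'a metric \<Rightarrow> real \<Rightarrow> 'a set \<Rightarrow> bool" where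
  "maximal_separated_set m \<epsilon> P \<longleftrightarrow>
    separated_set m \<epsilon> P \<and> (\<forall>P'. separated_set m \<epsilon> P' \<and> P \<subseteq> P' \<longrightarrow> P' = P)"

definition filling_vertices :: "(nat \<Rightarrow> 'a set) \<Rightarrow> (nat \<times> 'a) set" where
  "filling_vertices P = {(k, p). p \<in> P k}"

definition filling_ball :: "'a metric \<Rightarrow> real \<Rightarrow> nat \<times> 'a \<Rightarrow> 'a set" where
  "filling_ball m s v = mball_of m (snd v) (2 * (1 / s ^ fst v))"

definition filling_edges :: "'a metric \<Rightarrow> real \<Rightarrow> (nat \<Rightarrow> 'a set) \<Rightarrow> (nat \<times> 'a) set set" where
  "filling_edges m s P =
    {{v, w} | v w. v \<in> filling_vertices P \<and> w \<in> filling_vertices P \<and> v \<noteq> w \<and>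
       \<bar>int (fst v) - int (fst w)\<bar> \<le> 1 \<and> filling_ball m s v \<inter> filling_ball m s w \<noteq> {}}"

text \<open>Here \<open>c\<close> is the factor by which the metric is rescaled. Connectedness need not be required:
  see \<open>hyperbolic_filling_connected\<close> below.\<close>

definition hyperbolic_filling ::
    "'a metric \<Rightarrow> (nat \<times> 'a) set \<Rightarrow> (nat \<times> 'a) set set \<Rightarrow> bool" where
  "hyperbolic_filling Z V E \<longleftrightarrow>
    (\<exists>c s P. c > 0 \<and> mdiameter (scaled_metric c Z) (mspace Z) < 1 \<and> s > 1 \<and>
      (\<forall>k. maximal_separated_set (scaled_metric c Z) (1 / s ^ k) (P k)) \<and>
      V = filling_vertices P \<and> E = filling_edges (scaled_metric c Z) s P)"

lemma maximal_separated_set_covers: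
  assumes "maximal_separated_set m \<epsilon> P" "x \<in> mspace m" "\<epsilon> > 0"
  obtains p where "p \<in> P" "mdist m p x < \<epsilon>"
proof (rule ccontr)
  assume "\<not> thesis"
  with that have far: "\<epsilon> \<le> mdist m p x" if "p \<in> P" for p
    using that by (meson not_le)
  have P: "separated_set m \<epsilon> P"
    using assms by (simp add: maximal_separated_set_def)
  have "separated_set m \<epsilon> (insert x P)"
    using P far assms(2) unfolding separated_set_def by (auto simp: mdist_commute)
  then have "x \<in> P"
    using assms(1) unfolding maximal_separated_set_def by blast
  then show False
    using far[of x] assms(2,3) Metric_space.mdist_zero[OF Metric_space_mspace_mdist, of x m] by auto
qed

lemma hyperbolic_filling_connected:
  assumes "hyperbolic_filling Z V E"
  shows "graph_connected V E"
proof -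
  from assms obtain c s P where c: "c > 0" and s: "s > 1"
    and diam: "mdiameter (scaled_metric c Z) (mspace Z) < 1"
    and max: "\<And>k. maximal_separated_set (scaled_metric c Z) (1 / s ^ k) (P k)"
    and V: "V = filling_vertices P" and E: "E = filling_edges (scaled_metric c Z) s P"
    unfolding hyperbolic_filling_def by blast
  let ?m = "scaled_metric c Z"
  have P_sub: "P k \<subseteq> mspace ?m" for k
    using max[of k] by (simp add: maximal_separated_set_def separated_set_def)
  have lt1: "mdist ?m x y < 1" if "x \<in> mspace ?m" "y \<in> mspace ?m" for x y
  proof -
    have "ennreal (mdist ?m x y) \<le> mdiameter ?m (mspace Z)"
      unfolding mdiameter_def using that c
      by (intro SUP_upper2[of x] SUP_upper2[of y] order_refl) (simp_all del: mdist_scaled_metric)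
    then have "ennreal (mdist ?m x y) < 1"
      using diam by (rule le_less_trans)
    then show ?thesis
      by (simp add: ennreal_less_one_iff del: mdist_scaled_metric)
  qed
  have base: "p = q" if "p \<in> P 0" "q \<in> P 0" for p q
  proof (rule ccontr)
    assume "p \<noteq> q"
    then have "1 \<le> mdist ?m p q"
      using max[of 0] that by (simp add: maximal_separated_set_def separated_set_def)
    then show False
      using lt1[of p q] that P_sub[of 0] by (meson not_le subsetD)
  qed
  have down: "\<exists>q. (0, q) \<in> V \<and> ((k, p), (0, q)) \<in> (adjacency E)\<^sup>*" if "(k, p) \<in> V" for k p
    using that
  proof (induction k arbitrary: p)
    case (Suc k)
    then have p: "p \<in> P (Suc k)" and pm: "p \<in> mspace ?m"
      using P_sub by (auto simp: V filling_vertices_def)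
    obtain q where q: "q \<in> P k" "mdist ?m q p < 1 / s ^ k"
      using maximal_separated_set_covers[OF max pm] s
      by (metis less_trans zero_less_divide_1_iff zero_less_one zero_less_power)
    have "q \<in> mspace ?m" using P_sub q by blast
    have "mdist ?m p p = 0"
      using pm by (rule Metric_space.mdist_zero[OF Metric_space_mspace_mdist])
    have "0 < 1 / s ^ k" using s by simp
    then have "mdist ?m q p < 2 * (1 / s ^ k)" using q(2) by linarith
    then have "p \<in> filling_ball ?m s (k, q)" "p \<in> filling_ball ?m s (Suc k, p)"
      unfolding filling_ball_def using pm \<open>q \<in> mspace ?m\<close> \<open>mdist ?m p p = 0\<close> s
      by (simp_all del: mdist_scaled_metric mdist_zero)
    then have "{(Suc k, p), (k, q)} \<in> E"
      unfolding E filling_edges_def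
      by (intro CollectI exI[of _ "(Suc k, p)"] exI[of _ "(k, q)"])
        (use p q in \<open>auto simp: filling_vertices_def\<close>)
    then have "((Suc k, p), (k, q)) \<in> adjacency E"
      by (simp add: adjacency_def)
    moreover have "(k, q) \<in> V"
      using q by (simp add: V filling_vertices_def)
    ultimately show ?case
      using Suc.IH by (meson converse_rtrancl_into_rtrancl)
  qed auto
  have symE: "(w, v) \<in> (adjacency E)\<^sup>*" if "(v, w) \<in> (adjacency E)\<^sup>*" for v w
    using that by (metis adjacency_relpow_sym rtrancl_power)
  show ?thesis
    unfolding graph_connected_def
  proof (intro ballI)
    fix v w assume "v \<in> V" "w \<in> V"
    then obtain q r where "(0, q) \<in> V" "(v, (0, q)) \<in> (adjacency E)\<^sup>*"
      and "(0, r) \<in> V" "(w, (0, r)) \<in> (adjacency E)\<^sup>*"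
      using down by (metis surj_pair)
    moreover from this have "q = r"
      using base by (simp add: V filling_vertices_def)
    ultimately show "(v, w) \<in> (adjacency E)\<^sup>*"
      using symE by (meson rtrancl_trans)
  qed
qed

end

theory Submission
  imports Defs
begin

text \<open>
  A vertex of a hyperbolic filling stands for a ball of the space, given by a centre and a radius.
  Two vertices whose radii are comparable and whose centres lie within a bounded multiple of these
  radii are at bounded graph distance, and adjacent vertices are of this kind; call such vertices
  near. So a bijection between vertex sets is bilipschitz as soon as it and its inverse preserve
  nearness up to a change of constants (\<open>bilipschitz_equivalent_fillingsI\<close>).

  A quasisymmetry \<open>f\<close> gives a relation between the vertices of the two fillings: a ball in \<open>Z\<close>
  corresponds to a ball in \<open>W\<close> if some pair of points spans the scale of the first while its image
  spans the scale of the second. As \<open>f\<close> distorts ratios of distances in a controlled way, vertices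
  that correspond to near vertices are near (\<open>corr_coarsely_continuous\<close>). The relation is symmetric
  under exchange of \<open>f\<close> with its inverse, so it remains to find a bijection contained in it.

  This is where Ahlfors regularity enters, through two consequences. Comparing the measures of
  concentric balls shows that no annulus of large ratio is empty (uniform perfectness); counting
  disjoint balls by their measure shows that a separated set has bounded size if it lies in a ball of
  radius comparable to the separation (doubling).
  By uniform perfectness each vertex has a corresponding one, which gives a map \<open>F\<close> between the vertex
  sets, and by doubling the fibres of \<open>F\<close> have at most \<open>N\<close> elements for some \<open>N\<close>. Again by uniform
  perfectness, each vertex of the target has \<open>N\<close> near vertices some fixed number of levels further
  down, in such a way that these families are disjoint (\<open>disjoint_near_families\<close>). This is the
  nonamenability of the filling in a form strong enough to replace the marriage theorem: mapping each
  fibre injectively into the family below its image turns \<open>F\<close> into an injection that is still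
  contained in the relation. By symmetry there is an injection in the other direction, and the
  Schroeder-Bernstein construction glues pieces of the two into a bijection.

  A space with at most one point has no positive scale, so uniform perfectness fails if it has a
  point; there the vertices form at most a single ray, and matching levels is bilipschitz.
\<close>

section \<open>Injections, bijections and graph distances\<close>

text \<open>The values of the bijection matter here, not only its existence: each of them comes from one of the
  two injections, so a relation that contains both injections contains the bijection. The set \<open>X\<close>
  on which \<open>i\<close> is used is a fixed point, which makes \<open>j\<close> map the points missed by \<open>i ` X\<close>
  onto the complement of \<open>X\<close>.\<close>
lemma Schroeder_Bernstein_pointwise:
  assumes "inj_on i A" "i ` A \<subseteq> B" "inj_on j B" "j ` B \<subseteq> A"
  shows "\<exists>h. bij_betw h A B \<and> (\<forall>x\<in>A. h x = i x \<or> j (h x) = x)"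
proof -
  define X where "X = lfp (\<lambda>X. A - j ` (B - i ` X))"
  have X: "X = A - j ` (B - i ` X)"
    unfolding X_def by (rule lfp_unfold) (blast intro: monoI)
  then have X_iff: "x \<in> X \<longleftrightarrow> x \<in> A \<and> x \<notin> j ` (B - i ` X)" for x
    by (metis Diff_iff)
  define h where "h = (\<lambda>x. if x \<in> X then i x else inv_into B j x)"
  have out: "inv_into B j x \<in> B - i ` X \<and> j (inv_into B j x) = x" if "x \<in> A - X" for x
  proof -
    have "x \<in> j ` (B - i ` X)"
      using that X_iff[of x] by blast
    then show ?thesis
      using inj_on_subset[OF assms(3)] assms(3) by (auto simp: inv_into_f_f)
  qed
  have "inj_on h A"
  proof (rule inj_onI)
    fix x y assume xy: "x \<in> A" "y \<in> A" "h x = h y"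
    show "x = y"
    proof (cases "x \<in> X"; cases "y \<in> X")
      assume "x \<in> X" "y \<in> X"
      then show ?thesis
        using xy inj_onD[OF assms(1)] by (simp add: h_def)
    next
      assume X: "x \<in> X" "y \<notin> X"
      then have "inv_into B j y \<notin> i ` X" "inv_into B j y = i x"
        using out[of y] xy by (auto simp: h_def)
      then show ?thesis
        using X by blast
    next
      assume X: "x \<notin> X" "y \<in> X"
      then have "inv_into B j x \<notin> i ` X" "inv_into B j x = i y"
        using out[of x] xy by (auto simp: h_def)
      then show ?thesis
        using X by blast
    next
      assume "x \<notin> X" "y \<notin> X"
      then show ?thesis
        using out[of x] out[of y] xy by (metis DiffI h_def)
    qed
  qed
  moreover have "h ` A \<subseteq> B"
    using out assms(2) by (simp add: h_def image_subset_iff)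
  moreover have "y \<in> h ` A" if "y \<in> B" for y
  proof (cases "y \<in> i ` X")
    case True
    then obtain x where "x \<in> X" "y = i x"
      by blast
    moreover from this have "x \<in> A"
      using X_iff by metis
    ultimately show ?thesis
      by (intro image_eqI[of _ _ x]) (simp_all add: h_def)
  next
    case False
    then have "j y \<in> A" "j y \<notin> X"
      using that X_iff[of "j y"] assms(3,4) False by (blast dest: inj_onD)+
    moreover have "h (j y) = y"
      using \<open>j y \<notin> X\<close> that assms(3) by (simp add: h_def inv_into_f_f)
    ultimately show ?thesis
      by (metis imageI)
  qed
  ultimately have "bij_betw h A B"
    by (auto simp: bij_betw_def)
  moreover have "h x = i x \<or> j (h x) = x" if "x \<in> A" for x
    using out[of x] that by (auto simp: h_def)
  ultimately show ?thesis
    by blast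
qed

text \<open>Since the sets \<open>D y\<close> are disjoint, injectivity only has to be arranged on each fibre of \<open>F\<close>
  separately, where it is a matter of cardinality.\<close>
lemma injection_subordinate_to_map:
  assumes F: "F ` A \<subseteq> B"
    and fibre: "\<And>y. y \<in> B \<Longrightarrow> finite {x\<in>A. F x = y} \<and> card {x\<in>A. F x = y} \<le> N"
    and D: "\<And>y. y \<in> B \<Longrightarrow> finite (D y) \<and> N \<le> card (D y)"
    and disj: "\<And>y z. y \<in> B \<Longrightarrow> z \<in> B \<Longrightarrow> y \<noteq> z \<Longrightarrow> D y \<inter> D z = {}"
  shows "\<exists>i. inj_on i A \<and> (\<forall>x\<in>A. i x \<in> D (F x))"
proof -
  have "\<exists>g. g ` {x\<in>A. F x = y} \<subseteq> D y \<and> inj_on g {x\<in>A. F x = y}" if "y \<in> B" for y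
    using fibre[OF that] D[OF that] by (intro card_le_inj) auto
  then obtain g where g: "\<And>y. y \<in> B \<Longrightarrow> g y ` {x\<in>A. F x = y} \<subseteq> D y \<and> inj_on (g y) {x\<in>A. F x = y}"
    by metis
  have in_D: "g (F x) x \<in> D (F x)" if "x \<in> A" for x
    using g[of "F x"] F that by (auto simp: image_subset_iff)
  have "inj_on (\<lambda>x. g (F x) x) A"
  proof (rule inj_onI)
    fix x y assume xy: "x \<in> A" "y \<in> A" "g (F x) x = g (F y) y"
    then have "F x = F y"
      using disj[of "F x" "F y"] in_D[of x] in_D[of y] F by auto
    then show "x = y"
      using g[of "F x"] xy F by (auto simp: image_subset_iff inj_on_def)
  qed
  then show ?thesis
    using in_D by (intro exI[of _ "\<lambda>x. g (F x) x"]) simp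
qed

lemma graph_dist_le_relpow: "(v, w) \<in> adjacency E ^^ n \<Longrightarrow> graph_dist E v w \<le> n"
  unfolding graph_dist_def by (rule Least_le)

lemma graph_dist_triangle:
  assumes "graph_connected V E" "u \<in> V" "v \<in> V" "w \<in> V"
  shows "graph_dist E u w \<le> graph_dist E u v + graph_dist E v w"
  using Metric_space.triangle[OF Metric_space_graph_dist[OF assms(1)] assms(2-4)] by linarith

lemma graph_dist_refl [simp]: "graph_dist E v v = 0"
  unfolding graph_dist_def by (rule Least_eq_0) simp

lemma graph_dist_edge: "{v, w} \<in> E \<Longrightarrow> graph_dist E v w \<le> 1"
  using graph_dist_le_relpow[of v w 1 E] by (simp add: adjacency_def)

text \<open>A geodesic is a chain of edges, so a bound on the image of each edge adds up along it.\<close>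
lemma graph_dist_Lipschitz_from_edges:
  assumes conn: "graph_connected V E" "graph_connected V' E'" and "\<Union>E \<subseteq> V" "h ` V \<subseteq> V'"
    and edge: "\<And>v w. {v, w} \<in> E \<Longrightarrow> graph_dist E' (h v) (h w) \<le> L"
    and "v \<in> V" "w \<in> V"
  shows "graph_dist E' (h v) (h w) \<le> L * graph_dist E v w"
proof -
  have "w \<in> V \<and> graph_dist E' (h v) (h w) \<le> L * n" if "(v, w) \<in> adjacency E ^^ n" for w n
    using that
  proof (induction n arbitrary: w)
    case 0
    then show ?case
      using \<open>v \<in> V\<close> by simp
  next
    case (Suc n)
    then obtain u where u: "(v, u) \<in> adjacency E ^^ n" "{u, w} \<in> E"
      by (auto simp: adjacency_def)
    then have "w \<in> V" "u \<in> V"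
      using \<open>\<Union>E \<subseteq> V\<close> by blast+
    then have "graph_dist E' (h v) (h w) \<le> graph_dist E' (h v) (h u) + graph_dist E' (h u) (h w)"
      using assms by (intro graph_dist_triangle[OF conn(2)]) auto
    also have "\<dots> \<le> L * n + L"
      using Suc.IH[OF u(1)] edge[OF u(2)] by linarith
    finally show ?case
      using \<open>w \<in> V\<close> by simp
  qed
  then show ?thesis
    using graph_dist_relpow[OF conn(1) \<open>v \<in> V\<close> \<open>w \<in> V\<close>] by blast
qed

lemma bilipschitz_equivalent_graph_metricI:
  assumes conn: "graph_connected V E" "graph_connected V' E'"
    and sub: "\<Union>E \<subseteq> V" "\<Union>E' \<subseteq> V'" and h: "bij_betw h V V'"
    and edge: "\<And>v w. {v, w} \<in> E \<Longrightarrow> graph_dist E' (h v) (h w) \<le> L"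
    and edge': "\<And>v w. v \<in> V \<Longrightarrow> w \<in> V \<Longrightarrow> {h v, h w} \<in> E' \<Longrightarrow> graph_dist E v w \<le> L'"
  shows "bilipschitz_equivalent (graph_metric V E) (graph_metric V' E')"
proof -
  let ?k = "inv_into V h"
  let ?C = "real (L + L' + 1)"
  have k: "bij_betw ?k V' V"
    using h by (rule bij_betw_inv_into)
  have inv_edge: "graph_dist E (?k v) (?k w) \<le> L'" if "{v, w} \<in> E'" for v w
  proof -
    have "v \<in> V'" "w \<in> V'"
      using that sub by auto
    then show ?thesis
      using that h k by (intro edge') (auto simp: bij_betw_inv_into_right bij_betw_apply)
  qed
  have bounds: "graph_dist E' (h v) (h w) \<le> L * graph_dist E v w"
      "graph_dist E v w \<le> L' * graph_dist E' (h v) (h w)" if "v \<in> V" "w \<in> V" for v w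
  proof -
    show "graph_dist E' (h v) (h w) \<le> L * graph_dist E v w"
      using h that
      by (intro graph_dist_Lipschitz_from_edges[OF conn sub(1) _ edge]) (auto simp: bij_betw_def)
    have "graph_dist E (?k (h v)) (?k (h w)) \<le> L' * graph_dist E' (h v) (h w)"
      using h k that
      by (intro graph_dist_Lipschitz_from_edges[OF conn(2,1) sub(2) _ inv_edge])
        (auto simp: bij_betw_def)
    then show "graph_dist E v w \<le> L' * graph_dist E' (h v) (h w)"
      using h that by (simp add: bij_betw_inv_into_left)
  qed
  have "1 / ?C * real (graph_dist E v w) \<le> real (graph_dist E' (h v) (h w))
      \<and> real (graph_dist E' (h v) (h w)) \<le> ?C * real (graph_dist E v w)" if "v \<in> V" "w \<in> V" for v w
  proof -
    have "graph_dist E v w \<le> (L + L' + 1) * graph_dist E' (h v) (h w)"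
      by (rule order_trans[OF bounds(2)[OF that]]) (simp add: algebra_simps)
    moreover have "graph_dist E' (h v) (h w) \<le> (L + L' + 1) * graph_dist E v w"
      by (rule order_trans[OF bounds(1)[OF that]]) (simp add: algebra_simps)
    ultimately have "real (graph_dist E v w) \<le> ?C * real (graph_dist E' (h v) (h w))"
      "real (graph_dist E' (h v) (h w)) \<le> ?C * real (graph_dist E v w)"
      by (metis of_nat_le_iff of_nat_mult)+
    then show ?thesis
      by (simp add: field_simps)
  qed
  then show ?thesis
    unfolding bilipschitz_equivalent_def
    using h by (intro exI[of _ h] exI[of _ ?C])
      (simp add: mspace_graph_metric[OF conn(1)] mspace_graph_metric[OF conn(2)]
        mdist_graph_metric[OF conn(1)] mdist_graph_metric[OF conn(2)])
qed

section \<open>Nearness of vertices\<close>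

lemma scaled_metric_one [simp]: "scaled_metric 1 m = m"
  by (simp add: scaled_metric_def)

lemma mdist_self [simp]: "x \<in> mspace m \<Longrightarrow> mdist m x x = 0"
  by simp

lemma mdist_le_mdiameter:
  assumes "x \<in> S" "y \<in> S"
  shows "ennreal (mdist m x y) \<le> mdiameter m S"
  unfolding mdiameter_def using assms by (intro SUP_upper2[of x] SUP_upper2[of y]) auto

text \<open>The data of a hyperbolic filling, with the metric already rescaled.\<close>
locale filling_nets =
  fixes m :: "'a metric" and s :: real and P :: "nat \<Rightarrow> 'a set"
  assumes diam: "mdiameter m (mspace m) < 1"
    and s_gt_1: "1 < s"
    and maximal: "\<And>k. maximal_separated_set m (1 / s ^ k) (P k)"
begin

abbreviation V :: "(nat \<times> 'a) set" where "V \<equiv> filling_vertices P"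
abbreviation E :: "(nat \<times> 'a) set set" where "E \<equiv> filling_edges m s P"

definition radius :: "nat \<times> 'a \<Rightarrow> real" where
  "radius v = 1 / s ^ fst v"

text \<open>The balls of \<open>v\<close> and \<open>w\<close> agree up to scale, with constant \<open>M\<close>. Bounding the distance of the
  centres by both radii makes the relation symmetric without a change of constant.\<close>
definition near :: "real \<Rightarrow> nat \<times> 'a \<Rightarrow> nat \<times> 'a \<Rightarrow> bool" where
  "near M v w \<longleftrightarrow> radius v \<le> M * radius w \<and> radius w \<le> M * radius v \<and>
    mdist m (snd v) (snd w) \<le> M * radius v \<and> mdist m (snd v) (snd w) \<le> M * radius w"

lemma mdist_less_1: "mdist m x y < 1" if "x \<in> mspace m" "y \<in> mspace m"
proof -
  have "ennreal (mdist m x y) < 1"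
    using mdist_le_mdiameter[OF that] diam by (rule le_less_trans)
  then show ?thesis
    by (simp add: ennreal_less_one_iff)
qed

lemma radius_pos [simp]: "0 < radius v"
  using s_gt_1 by (simp add: radius_def)

lemma radius_le_1 [simp]: "radius v \<le> 1"
  using s_gt_1 by (simp add: radius_def one_le_power)

lemma connected: "graph_connected V E"
proof (rule hyperbolic_filling_connected)
  show "hyperbolic_filling m V E"
    unfolding hyperbolic_filling_def
    using diam s_gt_1 maximal by (intro exI[of _ 1] exI[of _ s] exI[of _ P]) simp
qed

lemma edges_subset: "\<Union>E \<subseteq> V"
  by (auto simp: filling_edges_def)

lemma vertex_in_space [simp]: "v \<in> V \<Longrightarrow> snd v \<in> mspace m"
  using maximal[of "fst v"]
  by (auto simp: filling_vertices_def maximal_separated_set_def separated_set_def)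

lemma vertex_separated:
  "v \<in> V \<Longrightarrow> w \<in> V \<Longrightarrow> fst v = fst w \<Longrightarrow> v \<noteq> w \<Longrightarrow> radius v \<le> mdist m (snd v) (snd w)"
  using maximal[of "fst v"]
  by (auto simp: filling_vertices_def maximal_separated_set_def separated_set_def radius_def)

lemma vertex_near_point:
  assumes "x \<in> mspace m"
  obtains v where "v \<in> V" "fst v = k" "mdist m (snd v) x < radius v"
proof -
  obtain p where "p \<in> P k" "mdist m p x < 1 / s ^ k"
    using maximal_separated_set_covers[OF maximal assms, of k] s_gt_1 by auto
  then show ?thesis
    by (intro that[of "(k, p)"]) (auto simp: filling_vertices_def radius_def)
qed

lemma level_of_scale:
  assumes "0 < \<rho>" "\<rho> \<le> 1"
  obtains k where "1 / s ^ Suc k < \<rho>" "\<rho> \<le> 1 / s ^ k"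
proof -
  obtain n where "1 / \<rho> < s ^ n"
    using real_arch_pow[OF s_gt_1] by blast
  then have n: "1 / s ^ n < \<rho>"
    using assms s_gt_1 by (simp add: field_simps)
  define k where "k = (LEAST k. 1 / s ^ Suc k < \<rho>)"
  have "1 / s ^ Suc n \<le> 1 / s ^ n"
    using s_gt_1 by (simp add: field_simps)
  with n have "1 / s ^ Suc n < \<rho>"
    by linarith
  then have "1 / s ^ Suc k < \<rho>"
    unfolding k_def by (rule LeastI)
  moreover have "\<rho> \<le> 1 / s ^ k"
  proof (cases k)
    case (Suc j)
    then have "\<not> 1 / s ^ Suc j < \<rho>"
      unfolding k_def by (intro not_less_Least) simp
    then show ?thesis
      using Suc by simp
  qed (use assms in simp)
  ultimately show ?thesis
    by (rule that)
qed

lemma in_filling_ball [simp]: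
  "x \<in> filling_ball m s v \<longleftrightarrow> snd v \<in> mspace m \<and> x \<in> mspace m \<and> mdist m (snd v) x < 2 * radius v"
  by (simp add: filling_ball_def radius_def)

lemma near_sym: "near M v w \<Longrightarrow> near M w v"
  by (auto simp: near_def mdist_commute)

lemma near_imp_ge_1:
  assumes "near M v w" shows "1 \<le> M"
proof (rule ccontr)
  assume "\<not> 1 \<le> M"
  then have "M * radius w < 1 * radius w" "M * radius v < 1 * radius v"
    by (auto intro!: mult_strict_right_mono)
  moreover have "radius v \<le> M * radius w" "radius w \<le> M * radius v"
    using assms by (auto simp: near_def)
  ultimately show False
    by linarith
qed

text \<open>On each level between those of \<open>v\<close> and \<open>w\<close> some ball contains the common point \<open>x\<close>, and balls on
  consecutive levels that contain \<open>x\<close> are adjacent.\<close>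
lemma graph_dist_of_common_point:
  assumes "v \<in> V" "w \<in> V" "x \<in> filling_ball m s v" "x \<in> filling_ball m s w"
  shows "graph_dist E v w \<le> (fst w - fst v) + (fst v - fst w) + 1"
proof -
  have edge: "graph_dist E v w \<le> 1"
    if "v \<in> V" "w \<in> V" "x \<in> filling_ball m s v" "x \<in> filling_ball m s w" "fst v \<le> fst w" "fst w \<le> fst v + 1" for v w
  proof (cases "v = w")
    case False
    then have "{v, w} \<in> E"
      using that unfolding filling_edges_def by (intro CollectI exI[of _ v] exI[of _ w]) auto
    then show ?thesis
      by (rule graph_dist_edge)
  qed simp
  have up: "graph_dist E v w \<le> n + 1 \<and> graph_dist E w v \<le> n + 1"
    if "v \<in> V" "w \<in> V" "x \<in> filling_ball m s v" "x \<in> filling_ball m s w" "fst w = fst v + n"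
    for v w n
    using that
  proof (induction n arbitrary: w)
    case 0
    then show ?case
      using edge[of v w] edge[of w v] by auto
  next
    case (Suc n)
    have "x \<in> mspace m"
      using Suc.prems(3) by simp
    then obtain u where u: "u \<in> V" "fst u = fst v + n" "mdist m (snd u) x < radius u"
      by (rule vertex_near_point)
    moreover have "mdist m (snd u) x < 2 * radius u"
      using u(3) radius_pos[of u] by linarith
    ultimately have "x \<in> filling_ball m s u"
      using \<open>x \<in> mspace m\<close> by simp
    then have uw: "graph_dist E u w \<le> 1" "graph_dist E v u \<le> n + 1" "graph_dist E u v \<le> n + 1"
      using edge[of u w] Suc u by auto
    have "graph_dist E w u = graph_dist E u w"
      unfolding graph_dist_def using adjacency_relpow_sym by metis
    then show ?case
      using uw graph_dist_triangle[OF connected, of v u w] graph_dist_triangle[OF connected, of w u v]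
        Suc.prems u(1) by auto
  qed
  show ?thesis
  proof (cases "fst v \<le> fst w")
    case True
    then show ?thesis
      using up[OF assms, of "fst w - fst v"] by simp
  next
    case False
    then show ?thesis
      using up[OF assms(2,1,4,3), of "fst v - fst w"] by simp
  qed
qed

lemma level_diff_of_radius:
  obtains a where "M \<le> s ^ a" "\<And>v w. radius v \<le> M * radius w \<Longrightarrow> fst w \<le> fst v + a"
proof -
  obtain a where a: "M < s ^ a"
    using real_arch_pow[OF s_gt_1] by blast
  have "fst w \<le> fst v + a" if "radius v \<le> M * radius w" for v w
  proof (rule ccontr)
    assume "\<not> fst w \<le> fst v + a"
    then have "s ^ (fst v + a) \<le> s ^ fst w"
      using s_gt_1 by (intro power_increasing) auto
    moreover have "s ^ fst w \<le> M * s ^ fst v"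
      using that s_gt_1 by (simp add: radius_def field_simps)
    moreover have "M * s ^ fst v < s ^ a * s ^ fst v"
      using a s_gt_1 by (intro mult_strict_right_mono) auto
    ultimately show False
      by (simp add: power_add mult.commute)
  qed
  then show ?thesis
    using a by (intro that[of a]) auto
qed

lemma radius_le_of_level_le:
  assumes "fst w \<le> fst v + a"
  shows "radius v \<le> s ^ a * radius w"
proof -
  have "s ^ fst w \<le> s ^ (fst v + a)"
    using assms s_gt_1 by (intro power_increasing) auto
  then show ?thesis
    using s_gt_1 by (simp add: radius_def field_simps power_add)
qed

text \<open>If \<open>s ^ a\<close> exceeds \<open>M\<close>, then \<open>a\<close> levels above \<open>v\<close> there is a ball large enough to contain both
  centres, and each of \<open>v\<close> and \<open>w\<close> is joined to it through its own centre.\<close>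
lemma near_imp_bounded_dist:
  obtains L where "\<And>v w. v \<in> V \<Longrightarrow> w \<in> V \<Longrightarrow> near M v w \<Longrightarrow> graph_dist E v w \<le> L"
proof -
  obtain a where a: "M \<le> s ^ a" "\<And>v w. radius v \<le> M * radius w \<Longrightarrow> fst w \<le> fst v + a"
    using level_diff_of_radius[of M] by blast
  have "graph_dist E v w \<le> 3 * a + 2" if vw: "v \<in> V" "w \<in> V" "near M v w" for v w
  proof -
    \<comment> \<open>If \<open>v\<close> has fewer than \<open>a\<close> levels above it, truncation gives \<open>j = 0\<close>, and a ball of level \<open>0\<close>
      contains every point.\<close>
    define j where "j = fst v - a"
    obtain u where u: "u \<in> V" "fst u = j" "mdist m (snd u) (snd v) < radius u"
      using vertex_near_point[of "snd v" j] vw by auto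
    have "mdist m (snd u) (snd w) < 2 * radius u"
    proof (cases "a \<le> fst v")
      case True
      then have "fst v = j + a"
        by (simp add: j_def)
      then have "M * radius v \<le> radius u"
        using a(1) u(2) s_gt_1 by (simp add: radius_def power_add field_simps)
      moreover have "mdist m (snd v) (snd w) \<le> M * radius v"
        using vw by (simp add: near_def)
      ultimately show ?thesis
        using mdist_triangle[of "snd u" m "snd v" "snd w"] u vw by simp
    next
      case False
      then have "radius u = 1"
        using u by (simp add: j_def radius_def)
      then show ?thesis
        using mdist_less_1[of "snd u" "snd w"] u vw by simp
    qed
    then have "snd w \<in> filling_ball m s u"
      using u vw by simp
    moreover have "mdist m (snd u) (snd v) < 2 * radius u"
      using u(3) radius_pos[of u] by linarith
    then have "snd v \<in> filling_ball m s u"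
      using u vw by simp
    moreover have "snd v \<in> filling_ball m s v" "snd w \<in> filling_ball m s w"
      using vw by simp_all
    ultimately have "graph_dist E v u \<le> (fst u - fst v) + (fst v - fst u) + 1"
      "graph_dist E u w \<le> (fst w - fst u) + (fst u - fst w) + 1"
      using graph_dist_of_common_point u vw by blast+
    moreover have "fst w \<le> fst v + a" "fst v \<le> fst w + a"
      using a(2) vw by (auto simp: near_def)
    moreover have "graph_dist E v w \<le> graph_dist E v u + graph_dist E u w"
      using graph_dist_triangle[OF connected] u vw by blast
    ultimately show ?thesis
      using u(2) unfolding j_def by linarith
  qed
  then show ?thesis
    by (rule that)
qed

lemma edge_imp_near:
  assumes "{v, w} \<in> E"
  shows "near (2 + 2 * s) v w"
proof -
  have *: "near (2 + 2 * s) v w" if "v \<in> V" "w \<in> V" "x \<in> filling_ball m s v" "x \<in> filling_ball m s w"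
    "fst w = fst v \<or> fst w = Suc (fst v)" for v w x
  proof -
    have r: "radius w \<le> radius v" "radius v \<le> s * radius w"
      using that(5) s_gt_1 by (auto simp: radius_def field_simps)
    have "mdist m (snd v) (snd w) \<le> mdist m (snd v) x + mdist m x (snd w)"
      using that by (intro mdist_triangle) auto
    also have "\<dots> \<le> 2 * radius v + 2 * radius w"
      using that by (intro add_mono) (auto simp: mdist_commute)
    finally have d: "mdist m (snd v) (snd w) \<le> 2 * radius v + 2 * radius w" .
    have "1 * radius v \<le> s * radius v" "1 * radius w \<le> s * radius w"
      using s_gt_1 by (auto intro!: mult_right_mono less_imp_le[OF radius_pos])
    moreover have "(2 + 2 * s) * radius v = 2 * radius v + 2 * (s * radius v)"
      "(2 + 2 * s) * radius w = 2 * radius w + 2 * (s * radius w)"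
      by (simp_all add: algebra_simps)
    moreover have "0 < radius v" "0 < radius w"
      by simp_all
    ultimately show ?thesis
      using d r unfolding near_def by (intro conjI; linarith)
  qed
  obtain v' w' where vw: "{v, w} = {v', w'}" "v' \<in> V" "w' \<in> V"
    "\<bar>int (fst v') - int (fst w')\<bar> \<le> 1" "filling_ball m s v' \<inter> filling_ball m s w' \<noteq> {}"
    using assms unfolding filling_edges_def by blast
  then obtain x where "x \<in> filling_ball m s v'" "x \<in> filling_ball m s w'"
    by blast
  moreover have "fst w' = fst v' \<or> fst w' = Suc (fst v') \<or> fst v' = Suc (fst w')"
    using vw(4) by linarith
  ultimately have "near (2 + 2 * s) v' w'" "near (2 + 2 * s) w' v'"
    using *[of v' w' x] *[of w' v' x] vw near_sym by blast+
  then show ?thesis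
    using vw(1) by (auto simp: doubleton_eq_iff)
qed

end

text \<open>Adjacent vertices are near with a fixed constant, so their images are near, and near vertices are at
  bounded graph distance. Hence \<open>h\<close> and its inverse stretch each edge by a bounded factor.\<close>
lemma bilipschitz_equivalent_fillingsI:
  assumes X: "filling_nets m s P" and Y: "filling_nets m' s' P'"
    and h: "bij_betw h (filling_vertices P) (filling_vertices P')"
    and fwd: "\<And>M. \<exists>M'. \<forall>v\<in>filling_vertices P. \<forall>w\<in>filling_vertices P.
      filling_nets.near m s M v w \<longrightarrow> filling_nets.near m' s' M' (h v) (h w)"
    and bwd: "\<And>M. \<exists>M'. \<forall>v\<in>filling_vertices P. \<forall>w\<in>filling_vertices P.
      filling_nets.near m' s' M (h v) (h w) \<longrightarrow> filling_nets.near m s M' v w"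
  shows "bilipschitz_equivalent (graph_metric (filling_vertices P) (filling_edges m s P))
    (graph_metric (filling_vertices P') (filling_edges m' s' P'))"
proof -
  interpret X: filling_nets m s P by fact
  interpret Y: filling_nets m' s' P' by fact
  obtain M' where M': "\<And>v w. v \<in> X.V \<Longrightarrow> w \<in> X.V \<Longrightarrow> X.near (2 + 2 * s) v w \<Longrightarrow> Y.near M' (h v) (h w)"
    using fwd by blast
  obtain M where M: "\<And>v w. v \<in> X.V \<Longrightarrow> w \<in> X.V \<Longrightarrow> Y.near (2 + 2 * s') (h v) (h w) \<Longrightarrow> X.near M v w"
    using bwd by blast
  obtain L' where L': "\<And>v w. v \<in> Y.V \<Longrightarrow> w \<in> Y.V \<Longrightarrow> Y.near M' v w \<Longrightarrow> graph_dist Y.E v w \<le> L'"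
    using Y.near_imp_bounded_dist by blast
  obtain L where L: "\<And>v w. v \<in> X.V \<Longrightarrow> w \<in> X.V \<Longrightarrow> X.near M v w \<Longrightarrow> graph_dist X.E v w \<le> L"
    using X.near_imp_bounded_dist by blast
  have hV: "h v \<in> Y.V" if "v \<in> X.V" for v
    using h that by (rule bij_betw_apply)
  show ?thesis
  proof (rule bilipschitz_equivalent_graph_metricI[OF X.connected Y.connected X.edges_subset Y.edges_subset h])
    fix v w assume e: "{v, w} \<in> X.E"
    then have "v \<in> X.V" "w \<in> X.V"
      using X.edges_subset by auto
    then show "graph_dist Y.E (h v) (h w) \<le> L'"
      using L' hV M' X.edge_imp_near[OF e] by blast
  next
    fix v w assume "v \<in> X.V" "w \<in> X.V" "{h v, h w} \<in> Y.E"
    then show "graph_dist X.E v w \<le> L"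
      using L M Y.edge_imp_near by blast
  qed
qed

section \<open>Doubling and uniform perfectness\<close>

text \<open>Doubling in terms of the cardinality of separated sets, which is how it bounds numbers of
  vertices.\<close>
definition doubling :: "'a metric \<Rightarrow> bool" where
  "doubling m \<longleftrightarrow> (\<forall>M. \<exists>N. \<forall>x\<in>mspace m. \<forall>r>0. \<forall>S.
    separated_set m r S \<and> (\<forall>y\<in>S. mdist m x y \<le> M * r) \<longrightarrow> finite S \<and> card S \<le> N)"

text \<open>The constant \<open>l\<close> may depend on the bound \<open>R\<close> for the scales, which makes the notion invariant under
  rescaling and meaningful on bounded spaces with at least two points, where no annulus of radius
  beyond the diameter contains a point.\<close>
definition uniformly_perfect :: "'a metric \<Rightarrow> bool" where
  "uniformly_perfect m \<longleftrightarrow> (\<forall>R>0. \<exists>l>0. \<forall>x\<in>mspace m. \<forall>r. 0 < r \<and> r \<le> R \<longrightarrow>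
    (\<exists>y\<in>mspace m. l * r \<le> mdist m x y \<and> mdist m x y < r))"

text \<open>What remains of a quasisymmetry when the gauge \<open>\<eta>\<close> is only used to bound ratios: bounded ratios
  go to bounded ratios. Ratios may be compared this way also where \<open>x = z\<close>, as there is no division.\<close>
definition controls_ratios :: "'a metric \<Rightarrow> 'b metric \<Rightarrow> ('a \<Rightarrow> 'b) \<Rightarrow> bool" where
  "controls_ratios m m' f \<longleftrightarrow> (\<forall>C. \<exists>C'. \<forall>x\<in>mspace m. \<forall>y\<in>mspace m. \<forall>z\<in>mspace m.
    mdist m x y \<le> C * mdist m x z \<longrightarrow> mdist m' (f x) (f y) \<le> C' * mdist m' (f x) (f z))"

text \<open>Points \<open>y\<close> at distance about \<open>r\<close> from \<open>x\<close>, for \<open>r\<close> decreasing geometrically by the factor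
  \<open>l / 2\<close>, are separated by a multiple of the smallest of these scales: the later points are within
  half the distance of the earlier ones from \<open>x\<close>.\<close>
lemma uniformly_perfect_many_separated_points:
  assumes "uniformly_perfect m"
  shows "\<exists>\<delta>>0. \<delta> \<le> 1 \<and> (\<forall>x\<in>mspace m. \<forall>r. 0 < r \<and> r \<le> 1 \<longrightarrow>
    (\<exists>S. finite S \<and> card S = N \<and> separated_set m (\<delta> * r) S \<and> (\<forall>y\<in>S. mdist m x y < r)))"
proof -
  obtain l where "l > 0" and l: "\<And>x r. x \<in> mspace m \<Longrightarrow> 0 < r \<Longrightarrow> r \<le> 1 \<Longrightarrow>
      \<exists>y\<in>mspace m. l * r \<le> mdist m x y \<and> mdist m x y < r"
    using assms unfolding uniformly_perfect_def by (metis zero_less_one)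
  show ?thesis
  proof (induction N)
    case 0
    then show ?case
      by (intro exI[of _ 1]) (auto simp: separated_set_def intro!: exI[of _ "{}"])
  next
    case (Suc N)
    then obtain \<delta> where \<delta>: "\<delta> > 0" "\<delta> \<le> 1" and IH: "\<And>x r. x \<in> mspace m \<Longrightarrow> 0 < r \<Longrightarrow> r \<le> 1 \<Longrightarrow>
        \<exists>S. finite S \<and> card S = N \<and> separated_set m (\<delta> * r) S \<and> (\<forall>y\<in>S. mdist m x y < r)"
      by blast
    define \<epsilon> where "\<epsilon> = min 1 (\<delta> * (l / 2))"
    have "\<exists>S. finite S \<and> card S = Suc N \<and> separated_set m (\<epsilon> * r) S \<and> (\<forall>y\<in>S. mdist m x y < r)"
      if x: "x \<in> mspace m" and r: "0 < r" "r \<le> 1" for x r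
    proof -
      obtain y where y: "y \<in> mspace m" "l * r \<le> mdist m x y" "mdist m x y < r"
        using l[OF x r] by blast
      then have "0 < l * r" "l * r < r"
        using r \<open>l > 0\<close> mult_pos_pos[of l r] by linarith+
      then obtain S where S: "finite S" "card S = N" "separated_set m (\<delta> * (l * r / 2)) S"
        "\<And>z. z \<in> S \<Longrightarrow> mdist m x z < l * r / 2"
        using IH[OF x, of "l * r / 2"] r by (smt (verit) field_sum_of_halves)
      have S_sub: "S \<subseteq> mspace m"
        using S(3) by (simp add: separated_set_def)
      have y_far: "l * r / 2 \<le> mdist m y z" if "z \<in> S" for z
        using mdist_triangle[of x m z y] S(4)[OF that] y(1,2) that S_sub x
        by (auto simp: mdist_commute)
      have eps: "\<epsilon> * r \<le> \<delta> * (l * r / 2)"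
      proof -
        have "\<epsilon> * r \<le> (\<delta> * (l / 2)) * r"
          using r by (intro mult_right_mono) (auto simp: \<epsilon>_def)
        then show ?thesis
          by simp
      qed
      moreover have "\<delta> * (l * r / 2) \<le> 1 * (l * r / 2)"
        using \<delta> \<open>0 < l * r\<close> by (intro mult_right_mono) auto
      ultimately have "\<epsilon> * r \<le> l * r / 2"
        by linarith
      with y_far have y_sep: "\<epsilon> * r \<le> mdist m y z" "\<epsilon> * r \<le> mdist m z y" if "z \<in> S" for z
        using that by (metis mdist_commute order_trans)+
      have S_sep: "\<epsilon> * r \<le> mdist m p q" if "p \<in> S" "q \<in> S" "p \<noteq> q" for p q
        using S(3) eps that unfolding separated_set_def by (meson order_trans)
      have "separated_set m (\<epsilon> * r) (insert y S)"
        unfolding separated_set_def using S_sub y(1) y_sep S_sep by auto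
      moreover have "y \<notin> S"
        using y_far[of y] y(1) \<open>0 < l * r\<close> by auto
      moreover have "mdist m x z < r" if "z \<in> S" for z
        using S(4)[OF that] \<open>l * r < r\<close> \<open>0 < l * r\<close> by linarith
      ultimately show ?thesis
        using S(1,2) y(3) by (intro exI[of _ "insert y S"]) auto
    qed
    then show ?case
      using \<delta> \<open>l > 0\<close> by (intro exI[of _ \<epsilon>]) (auto simp: \<epsilon>_def)
  qed
qed

context filling_nets
begin

lemma near_refl: "v \<in> V \<Longrightarrow> near 1 v v"
  by (simp add: near_def less_imp_le)

text \<open>Near vertices lie on boundedly many levels, and those of one level form a separated set in a ball
  of comparable radius.\<close>
lemma near_finite_bounded:
  assumes "doubling m"
  obtains N where "\<And>v. v \<in> V \<Longrightarrow> finite {w\<in>V. near M v w} \<and> card {w\<in>V. near M v w} \<le> N"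
proof -
  obtain N where N: "\<forall>x\<in>mspace m. \<forall>r>0. \<forall>S. separated_set m r S \<and> (\<forall>y\<in>S. mdist m x y \<le> M * r) \<longrightarrow>
      finite S \<and> card S \<le> N"
    using assms unfolding doubling_def by blast
  obtain a where "M \<le> s ^ a" and a: "\<And>v w. radius v \<le> M * radius w \<Longrightarrow> fst w \<le> fst v + a"
    using level_diff_of_radius[of M] by blast
  have "finite {w\<in>V. near M v w} \<and> card {w\<in>V. near M v w} \<le> (2 * a + 1) * N" if v: "v \<in> V" for v
  proof -
    define S where "S k = {p \<in> P k. mdist m (snd v) p \<le> M * (1 / s ^ k)}" for k
    define I where "I = {fst v - a..fst v + a}"
    have S: "finite (S k) \<and> card (S k) \<le> N" for k
    proof (rule N[rule_format, of "snd v" "1 / s ^ k"])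
      have "separated_set m (1 / s ^ k) (S k)"
        using maximal[of k] by (auto simp: S_def maximal_separated_set_def separated_set_def)
      then show "separated_set m (1 / s ^ k) (S k) \<and> (\<forall>y\<in>S k. mdist m (snd v) y \<le> M * (1 / s ^ k))"
        by (simp add: S_def)
    qed (use v s_gt_1 in auto)
    have "{w\<in>V. near M v w} \<subseteq> Sigma I S"
    proof
      fix w assume "w \<in> {w\<in>V. near M v w}"
      then show "w \<in> Sigma I S"
        using a[of v w] a[of w v]
        by (cases w) (auto simp: near_def S_def I_def filling_vertices_def radius_def)
    qed
    moreover have "finite (Sigma I S)"
      using S by (auto simp: I_def)
    moreover have "card (Sigma I S) \<le> (2 * a + 1) * N"
    proof -
      have "card (Sigma I S) = (\<Sum>k\<in>I. card (S k))"
        using S by (intro card_SigmaI) (auto simp: I_def)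
      also have "\<dots> \<le> card I * N"
        using S sum_bounded_above[of I "\<lambda>k. card (S k)" N] by simp
      also have "\<dots> \<le> (2 * a + 1) * N"
        by (intro mult_right_mono) (auto simp: I_def)
      finally show ?thesis .
    qed
    ultimately show ?thesis
      by (meson card_mono finite_subset le_trans)
  qed
  then show ?thesis
    by (rule that)
qed

text \<open>Take for \<open>D v\<close> the vertices \<open>b\<close> levels below \<open>v\<close> that approximate \<open>N\<close> well separated points of the
  ball around the centre of \<open>v\<close>. The level of \<open>v\<close> can be read off from such a vertex, and the balls
  of half the radius around distinct centres of one level are disjoint; so distinct vertices get
  disjoint families.\<close>
lemma disjoint_near_families:
  assumes "uniformly_perfect m"
  obtains M D where "\<And>v. v \<in> V \<Longrightarrow> D v \<subseteq> {w\<in>V. near M v w}"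
    "\<And>v. v \<in> V \<Longrightarrow> finite (D v) \<and> card (D v) = N"
    "\<And>v w. v \<in> V \<Longrightarrow> w \<in> V \<Longrightarrow> v \<noteq> w \<Longrightarrow> D v \<inter> D w = {}"
proof -
  obtain \<delta> where \<delta>: "\<delta> > 0" "\<delta> \<le> 1" and many: "\<And>x r. x \<in> mspace m \<Longrightarrow> 0 < r \<Longrightarrow> r \<le> 1 \<Longrightarrow>
      \<exists>S. finite S \<and> card S = N \<and> separated_set m (\<delta> * r) S \<and> (\<forall>y\<in>S. mdist m x y < r)"
    using uniformly_perfect_many_separated_points[OF assms, of N] by blast
  \<comment> \<open>The separated points are taken within \<open>radius v / 4\<close>, at mutual distance \<open>\<delta> * radius v / 4\<close>;
    the constant \<open>16\<close> makes the error of approximation a quarter of this, so that distinct points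
    have distinct approximations.\<close>
  obtain b where b: "16 / \<delta> < s ^ b"
    using real_arch_pow[OF s_gt_1] by blast
  have family: "\<exists>D. finite D \<and> card D = N \<and> D \<subseteq> V \<and>
      (\<forall>w\<in>D. fst w = fst v + b \<and> mdist m (snd v) (snd w) < radius v / 2)" if v: "v \<in> V" for v
  proof -
    define r where "r = radius v / 4"
    have r: "0 < r" "r \<le> 1"
      using radius_pos[of v] radius_le_1[of v] by (auto simp: r_def simp del: radius_le_1)
    obtain S where S: "finite S" "card S = N" "separated_set m (\<delta> * r) S"
        "\<And>y. y \<in> S \<Longrightarrow> mdist m (snd v) y < r"
      using many[of "snd v" r] v r by auto
    have S_sub: "S \<subseteq> mspace m"
      using S(3) by (simp add: separated_set_def)
    have small: "radius w \<le> \<delta> * r / 4" if "fst w = fst v + b" for w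
    proof -
      have "16 \<le> \<delta> * s ^ b"
        using b \<delta> by (simp add: field_simps)
      then have "16 * radius w \<le> \<delta> * s ^ b * radius w"
        by (intro mult_right_mono) (auto simp: less_imp_le)
      also have "\<dots> = \<delta> * radius v"
        using that s_gt_1 by (simp add: radius_def power_add)
      finally show ?thesis
        by (simp add: r_def)
    qed
    have "\<exists>w\<in>V. fst w = fst v + b \<and> mdist m (snd w) y < \<delta> * r / 4" if "y \<in> S" for y
      using vertex_near_point[of y "fst v + b"] small S_sub that by (metis less_le_trans subsetD)
    then obtain w where w: "\<And>y. y \<in> S \<Longrightarrow> w y \<in> V \<and> fst (w y) = fst v + b \<and> mdist m (snd (w y)) y < \<delta> * r / 4"
      by metis
    have "inj_on w S"
    proof (rule inj_onI, rule ccontr)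
      fix y z assume yz: "y \<in> S" "z \<in> S" "w y = w z" "y \<noteq> z"
      then have "\<delta> * r \<le> mdist m y z"
        using S(3) by (simp add: separated_set_def)
      moreover have "mdist m y z \<le> mdist m y (snd (w y)) + mdist m (snd (w y)) z"
        using yz w S_sub by (intro mdist_triangle) auto
      moreover have "mdist m y (snd (w y)) < \<delta> * r / 4" "mdist m (snd (w y)) z < \<delta> * r / 4"
        using yz w by (metis mdist_commute)+
      moreover have "0 < \<delta> * r"
        using \<delta> r by simp
      ultimately show False
        by linarith
    qed
    moreover have "mdist m (snd v) (snd (w y)) < radius v / 2" if "y \<in> S" for y
    proof -
      have "mdist m (snd v) (snd (w y)) \<le> mdist m (snd v) y + mdist m y (snd (w y))"
        using that w v S_sub by (intro mdist_triangle) auto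
      also have "\<dots> < r + \<delta> * r / 4"
        using S(4)[OF that] w[OF that] by (simp add: mdist_commute)
      also have "\<dots> \<le> r + 1 * r / 4"
        using \<delta> r by (intro add_left_mono divide_right_mono mult_right_mono) auto
      also have "\<dots> < radius v / 2"
        using r by (simp add: r_def)
      finally show ?thesis .
    qed
    ultimately show ?thesis
      using S w by (intro exI[of _ "w ` S"]) (auto simp: card_image)
  qed
  then obtain D where D: "\<And>v. v \<in> V \<Longrightarrow> finite (D v) \<and> card (D v) = N \<and> D v \<subseteq> V \<and>
      (\<forall>w\<in>D v. fst w = fst v + b \<and> mdist m (snd v) (snd w) < radius v / 2)"
    by metis
  show ?thesis
  proof (rule that)
    show "D v \<subseteq> {w\<in>V. near (s ^ b) v w}" if v: "v \<in> V" for v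
    proof
      fix w assume "w \<in> D v"
      then have w: "w \<in> V" "fst w = fst v + b" "mdist m (snd v) (snd w) < radius v / 2"
        using D[OF v] by auto
      have "1 \<le> s ^ b"
        using s_gt_1 by (intro one_le_power) simp
      then have "1 * radius v \<le> s ^ b * radius v" "1 * radius w \<le> s ^ b * radius w"
        by (auto intro!: mult_right_mono less_imp_le[OF radius_pos])
      moreover have "radius v = s ^ b * radius w"
        using w s_gt_1 by (simp add: radius_def power_add)
      ultimately have "near (s ^ b) v w"
        using w(3) radius_pos[of v] unfolding near_def by (intro conjI; linarith)
      then show "w \<in> {w\<in>V. near (s ^ b) v w}"
        using w by simp
    qed
    show "D v \<inter> D w = {}" if vw: "v \<in> V" "w \<in> V" "v \<noteq> w" for v w
    proof (rule ccontr)
      assume "D v \<inter> D w \<noteq> {}"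
      then obtain u where "u \<in> D v" "u \<in> D w"
        by blast
      then have u: "u \<in> V" "fst u = fst v + b" "mdist m (snd v) (snd u) < radius v / 2"
          "fst u = fst w + b" "mdist m (snd w) (snd u) < radius w / 2"
        using D vw by blast+
      then have "fst v = fst w" "radius v = radius w"
        by (auto simp: radius_def)
      moreover have "mdist m (snd v) (snd w) \<le> mdist m (snd v) (snd u) + mdist m (snd u) (snd w)"
        using vw u by (intro mdist_triangle) auto
      ultimately show False
        using vertex_separated[OF vw(1,2)] vw(3) u(3,5) mdist_commute[of m "snd w" "snd u"]
        by simp
    qed
  qed (use D in auto)
qed

end

section \<open>Corresponding vertices\<close>

text \<open>Both maps are kept as parameters, so that every result can be used with the roles of the two spaces
  exchanged.\<close>
locale filling_correspondence = X: filling_nets m s P + Y: filling_nets m' s' P'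
  for m :: "'a metric" and s P and m' :: "'b metric" and s' P' +
  fixes f :: "'a \<Rightarrow> 'b" and g :: "'b \<Rightarrow> 'a"
  assumes f: "\<And>x. x \<in> mspace m \<Longrightarrow> f x \<in> mspace m' \<and> g (f x) = x"
    and g: "\<And>y. y \<in> mspace m' \<Longrightarrow> g y \<in> mspace m \<and> f (g y) = y"
    and ratios_f: "controls_ratios m m' f" and ratios_g: "controls_ratios m' m g"
begin

text \<open>The points \<open>a\<close> and \<open>b\<close> determine the ball of \<open>v\<close> up to scale, and their images determine the ball
  of \<open>w\<close>. Replacing \<open>a\<close>, \<open>b\<close> by their images shows that the relation is symmetric in the two
  spaces.\<close>
definition corr :: "real \<Rightarrow> nat \<times> 'a \<Rightarrow> nat \<times> 'b \<Rightarrow> bool" where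
  "corr B v w \<longleftrightarrow> (\<exists>a\<in>mspace m. \<exists>b\<in>mspace m.
    mdist m (snd v) a \<le> B * X.radius v \<and> mdist m (snd v) b \<le> B * X.radius v \<and>
    X.radius v \<le> B * mdist m a b \<and>
    mdist m' (snd w) (f a) \<le> B * Y.radius w \<and> mdist m' (snd w) (f b) \<le> B * Y.radius w \<and>
    Y.radius w \<le> B * mdist m' (f a) (f b))"

lemma swap: "filling_correspondence m' s' P' m s P g f"
  using f g ratios_f ratios_g X.filling_nets_axioms Y.filling_nets_axioms
  by (simp add: filling_correspondence_def filling_correspondence_axioms_def)

lemma corr_swap:
  assumes "corr B v w" shows "filling_correspondence.corr m' s' m s g B w v"
proof -
  interpret flip: filling_correspondence m' s' P' m s P g f
    by (rule swap)
  obtain a b where "a \<in> mspace m" "b \<in> mspace m"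
    "mdist m (snd v) a \<le> B * X.radius v \<and> mdist m (snd v) b \<le> B * X.radius v \<and>
    X.radius v \<le> B * mdist m a b \<and>
    mdist m' (snd w) (f a) \<le> B * Y.radius w \<and> mdist m' (snd w) (f b) \<le> B * Y.radius w \<and>
    Y.radius w \<le> B * mdist m' (f a) (f b)"
    using assms unfolding corr_def by blast
  then show ?thesis
    unfolding flip.corr_def using f by (intro bexI[of _ "f a"] bexI[of _ "f b"]) auto
qed

lemma corr_mono:
  assumes "corr B v w" "B \<le> B'" shows "corr B' v w"
proof -
  have "B * t \<le> B' * t" if "0 \<le> t" for t
    using assms(2) that by (rule mult_right_mono)
  then show ?thesis
    using assms(1) unfolding corr_def
    by (meson X.radius_pos Y.radius_pos less_imp_le mdist_nonneg order_trans)
qed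

lemma corr_near:
  assumes "corr B v w" "Y.near M w u" "v \<in> X.V" "w \<in> Y.V" "u \<in> Y.V"
  shows "corr (M + B * M) v u"
proof -
  have "1 \<le> M"
    using assms(2) by (rule Y.near_imp_ge_1)
  obtain a b where ab: "a \<in> mspace m" "b \<in> mspace m"
    "mdist m (snd v) a \<le> B * X.radius v" "mdist m (snd v) b \<le> B * X.radius v"
    "X.radius v \<le> B * mdist m a b"
    "mdist m' (snd w) (f a) \<le> B * Y.radius w" "mdist m' (snd w) (f b) \<le> B * Y.radius w"
    "Y.radius w \<le> B * mdist m' (f a) (f b)"
    using assms(1) unfolding corr_def by blast
  have "0 < B * mdist m a b"
    using ab(5) X.radius_pos[of v] by linarith
  then have "0 < B"
    using mdist_nonneg[of m a b] zero_less_mult_iff[of B "mdist m a b"] by linarith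
  have u: "Y.radius w \<le> M * Y.radius u" "Y.radius u \<le> M * Y.radius w"
    "mdist m' (snd u) (snd w) \<le> M * Y.radius u"
    using assms(2) by (auto simp: Y.near_def mdist_commute)
  have moved: "mdist m' (snd u) (f c) \<le> (M + B * M) * Y.radius u"
    if "c \<in> mspace m" "mdist m' (snd w) (f c) \<le> B * Y.radius w" for c
  proof -
    have "mdist m' (snd u) (f c) \<le> mdist m' (snd u) (snd w) + mdist m' (snd w) (f c)"
      using assms f that by (intro mdist_triangle) auto
    also have "\<dots> \<le> M * Y.radius u + B * (M * Y.radius u)"
      using that(2) u \<open>0 < B\<close> by (intro add_mono order_trans[OF that(2)] mult_left_mono) auto
    finally show ?thesis
      by (simp add: algebra_simps)
  qed
  have "B * 1 \<le> B * M"
    using \<open>1 \<le> M\<close> \<open>0 < B\<close> by (intro mult_left_mono) auto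
  then have "B \<le> M + B * M"
    using \<open>1 \<le> M\<close> by linarith
  then have grow: "B * t \<le> (M + B * M) * t" if "0 \<le> t" for t
    using that by (rule mult_right_mono)
  have "Y.radius u \<le> M * (B * mdist m' (f a) (f b))"
    using u(2) ab(8) \<open>1 \<le> M\<close> by (meson mult_left_mono order_trans zero_le_one)
  also have "\<dots> \<le> (M + B * M) * mdist m' (f a) (f b)"
    using \<open>1 \<le> M\<close> by (simp add: algebra_simps)
  finally have "Y.radius u \<le> (M + B * M) * mdist m' (f a) (f b)" .
  moreover have "B * X.radius v \<le> (M + B * M) * X.radius v" "B * mdist m a b \<le> (M + B * M) * mdist m a b"
    using grow by (simp_all add: less_imp_le)
  ultimately show ?thesis
    unfolding corr_def using ab(1-5) moved[OF ab(1,6)] moved[OF ab(2,7)]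
    by (intro bexI[of _ a] bexI[of _ b] conjI) (assumption | linarith)+
qed

text \<open>Since \<open>v\<close> and \<open>v'\<close> are near, all of \<open>a, b, a', b'\<close> lie within a bounded multiple of
  \<open>mdist m a b\<close> from \<open>a\<close>. Hence their images lie within a bounded multiple of the scale of \<open>w\<close>,
  and the scale of \<open>w'\<close>, which is spanned by the images of \<open>a'\<close> and \<open>b'\<close>, is not much larger. The
  reverse comparison of scales follows by exchanging the two pairs.\<close>
lemma corr_coarsely_continuous:
  obtains M' where "\<And>v v' w w'. v \<in> X.V \<Longrightarrow> v' \<in> X.V \<Longrightarrow> w \<in> Y.V \<Longrightarrow> w' \<in> Y.V \<Longrightarrow>
    corr B v w \<Longrightarrow> corr B v' w' \<Longrightarrow> X.near M v v' \<Longrightarrow> Y.near M' w w'"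
proof -
  \<comment> \<open>\<open>K\<close> bounds the distance from \<open>a\<close> to \<open>a'\<close> and \<open>b'\<close> in terms of the radius of \<open>v\<close>.\<close>
  define K where "K = B + M + B * M"
  obtain C0 where C0: "\<And>x y z. x \<in> mspace m \<Longrightarrow> y \<in> mspace m \<Longrightarrow> z \<in> mspace m \<Longrightarrow>
    mdist m x y \<le> (K * B) * mdist m x z \<Longrightarrow> mdist m' (f x) (f y) \<le> C0 * mdist m' (f x) (f z)"
    using ratios_f unfolding controls_ratios_def by metis
  define C where "C = max C0 0"
  have C: "mdist m' (f x) (f y) \<le> C * mdist m' (f x) (f z)"
    if "x \<in> mspace m" "y \<in> mspace m" "z \<in> mspace m" "mdist m x y \<le> (K * B) * mdist m x z" for x y z
    using C0[OF that] by (rule order_trans) (auto simp: C_def intro: mult_right_mono)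
  have "0 \<le> C"
    by (simp add: C_def)
  define M' where "M' = B + 2 * B * C + 4 * B * B * C + 4 * B * B * B * C"
  have one_sided: "Y.radius w' \<le> M' * Y.radius w \<and> mdist m' (snd w) (snd w') \<le> M' * Y.radius w"
    if V: "v \<in> X.V" "v' \<in> X.V" "w \<in> Y.V" "w' \<in> Y.V"
    and corr: "corr B v w" "corr B v' w'" and near: "X.near M v v'" for v v' w w'
  proof -
    obtain a b where ab: "a \<in> mspace m" "b \<in> mspace m"
      "mdist m (snd v) a \<le> B * X.radius v" "mdist m (snd v) b \<le> B * X.radius v"
      "X.radius v \<le> B * mdist m a b"
      "mdist m' (snd w) (f a) \<le> B * Y.radius w" "mdist m' (snd w) (f b) \<le> B * Y.radius w"
      using corr(1) unfolding corr_def by blast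
    obtain a' b' where ab': "a' \<in> mspace m" "b' \<in> mspace m"
      "mdist m (snd v') a' \<le> B * X.radius v'" "mdist m (snd v') b' \<le> B * X.radius v'"
      "mdist m' (snd w') (f a') \<le> B * Y.radius w'"
      "Y.radius w' \<le> B * mdist m' (f a') (f b')"
      using corr(2) unfolding corr_def by blast
    have "0 < B * mdist m a b"
      using ab(5) X.radius_pos[of v] by linarith
    then have "0 < B"
      using mdist_nonneg[of m a b] zero_less_mult_iff[of B "mdist m a b"] by linarith
    have "1 \<le> M"
      using near by (rule X.near_imp_ge_1)
    then have "0 \<le> K"
      using \<open>0 < B\<close> by (simp add: K_def)
    let ?t = "mdist m' (f a) (f b)"
    have image_close: "mdist m' (f a) (f c) \<le> C * ?t"
      if c: "c \<in> mspace m" "mdist m (snd v') c \<le> B * X.radius v'" for c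
    proof (rule C)
      have "mdist m a c \<le> mdist m a (snd v) + (mdist m (snd v) (snd v') + mdist m (snd v') c)"
        using ab ab' c V
          mdist_triangle[of a m "snd v" c] mdist_triangle[of "snd v" m "snd v'" c] by auto
      also have "\<dots> \<le> B * X.radius v + (M * X.radius v + B * (M * X.radius v))"
      proof (intro add_mono)
        show "mdist m (snd v') c \<le> B * (M * X.radius v)"
          using near \<open>0 < B\<close>
          by (intro order_trans[OF c(2)] mult_left_mono) (auto simp: X.near_def)
      qed (use ab near in \<open>auto simp: X.near_def mdist_commute\<close>)
      also have "\<dots> = K * X.radius v"
        by (simp add: K_def algebra_simps)
      also have "\<dots> \<le> K * (B * mdist m a b)"
        using ab(5) \<open>0 \<le> K\<close> by (rule mult_left_mono)
      finally show "mdist m a c \<le> (K * B) * mdist m a b"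
        by (simp add: mult.assoc)
    qed (use ab c in auto)
    have fm: "f a \<in> mspace m'" "f b \<in> mspace m'" "f a' \<in> mspace m'" "f b' \<in> mspace m'"
        "snd w \<in> mspace m'" "snd w' \<in> mspace m'"
      using f ab ab' V by auto
    have "?t \<le> mdist m' (f a) (snd w) + mdist m' (snd w) (f b)"
      using fm by (intro mdist_triangle)
    also have "\<dots> \<le> 2 * B * Y.radius w"
      using ab(6,7) by (simp add: mdist_commute)
    finally have t: "?t \<le> 2 * B * Y.radius w" .
    then have Ct: "C * ?t \<le> C * (2 * B * Y.radius w)"
      using \<open>0 \<le> C\<close> by (rule mult_left_mono)
    have "mdist m' (f a') (f b') \<le> mdist m' (f a') (f a) + mdist m' (f a) (f b')"
      using fm by (intro mdist_triangle)
    also have "\<dots> \<le> C * ?t + C * ?t"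
      using image_close[OF ab'(1,3)] image_close[OF ab'(2,4)]
      by (simp add: mdist_commute[of m' "f a'" "f a"])
    also have "\<dots> \<le> 4 * B * C * Y.radius w"
      using Ct by (simp add: algebra_simps)
    finally have "B * mdist m' (f a') (f b') \<le> B * (4 * B * C * Y.radius w)"
      using \<open>0 < B\<close> by (intro mult_left_mono) auto
    with ab'(6) have w': "Y.radius w' \<le> 4 * B * B * C * Y.radius w"
      by (simp add: algebra_simps)
    have "mdist m' (snd w) (snd w') \<le> mdist m' (snd w) (f a) + (mdist m' (f a) (f a') + mdist m' (f a') (snd w'))"
      using mdist_triangle[of "snd w" m' "f a" "snd w'"] mdist_triangle[of "f a" m' "f a'" "snd w'"] fm
      by auto
    also have "\<dots> \<le> B * Y.radius w + (C * (2 * B * Y.radius w) + B * (4 * B * B * C * Y.radius w))"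
    proof (intro add_mono)
      show "mdist m' (f a) (f a') \<le> C * (2 * B * Y.radius w)"
        using image_close[of a'] ab' Ct by auto
      have "mdist m' (f a') (snd w') \<le> B * Y.radius w'"
        using ab'(5) by (simp add: mdist_commute)
      also have "\<dots> \<le> B * (4 * B * B * C * Y.radius w)"
        using w' \<open>0 < B\<close> by (intro mult_left_mono) auto
      finally show "mdist m' (f a') (snd w') \<le> B * (4 * B * B * C * Y.radius w)" .
    qed (use ab in auto)
    finally have d: "mdist m' (snd w) (snd w') \<le> (B + 2 * B * C + 4 * B * B * B * C) * Y.radius w"
      by (simp add: algebra_simps)
    have "0 \<le> B + 2 * B * C + 4 * B * B * B * C" "0 \<le> 4 * B * B * C"
      using \<open>0 < B\<close> \<open>0 \<le> C\<close> by auto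
    then have "4 * B * B * C * Y.radius w \<le> M' * Y.radius w"
      "(B + 2 * B * C + 4 * B * B * B * C) * Y.radius w \<le> M' * Y.radius w"
      unfolding M'_def by (intro mult_right_mono; simp add: less_imp_le)+
    with w' d show ?thesis
      by linarith
  qed
  have "Y.near M' w w'"
    if "v \<in> X.V" "v' \<in> X.V" "w \<in> Y.V" "w' \<in> Y.V" "corr B v w" "corr B v' w'" "X.near M v v'" for v v' w w'
    using one_sided[OF that] one_sided[OF that(2,1,4,3,6,5) X.near_sym[OF that(7)]]
    by (simp add: Y.near_def mdist_commute)
  then show ?thesis
    by (rule that)
qed

text \<open>Uniform perfectness provides a second point \<open>x\<close> that spans the scale of \<open>v\<close> together with its
  centre; the distance of the two images selects the level of \<open>w\<close>.\<close>
lemma corr_exists: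
  assumes "uniformly_perfect m"
  obtains B where "\<And>v. v \<in> X.V \<Longrightarrow> \<exists>w\<in>Y.V. corr B v w"
proof -
  obtain l where "l > 0" and l: "\<And>x r. x \<in> mspace m \<Longrightarrow> 0 < r \<Longrightarrow> r \<le> 1 \<Longrightarrow>
      \<exists>y\<in>mspace m. l * r \<le> mdist m x y \<and> mdist m x y < r"
    using assms unfolding uniformly_perfect_def by (metis zero_less_one)
  define B where "B = max (1 / l) (max 2 s')"
  have "\<exists>w\<in>Y.V. corr B v w" if v: "v \<in> X.V" for v
  proof -
    have B: "t \<le> B * t" "2 * t \<le> B * t" "s' * t \<le> B * t" "(1 / l) * t \<le> B * t" if "0 \<le> t" for t
    proof -
      have "1 \<le> B" "2 \<le> B" "s' \<le> B" "1 / l \<le> B"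
        by (auto simp: B_def)
      then show "t \<le> B * t" "2 * t \<le> B * t" "s' * t \<le> B * t" "(1 / l) * t \<le> B * t"
        using that mult_right_mono[of _ B t] by (metis mult_1)+
    qed
    let ?p = "snd v"
    obtain x where x: "x \<in> mspace m" "l * X.radius v \<le> mdist m ?p x" "mdist m ?p x < X.radius v"
      using l[of ?p "X.radius v"] v by auto
    define \<rho> where "\<rho> = mdist m' (f ?p) (f x)"
    have fm: "f ?p \<in> mspace m'" "f x \<in> mspace m'"
      using f x v by auto
    have "?p \<noteq> x"
    proof
      assume "?p = x"
      then have "l * X.radius v \<le> 0"
        using x v by simp
      then show False
        using \<open>l > 0\<close> X.radius_pos[of v] by (simp add: mult_le_0_iff)
    qed
    then have "f ?p \<noteq> f x"
      using f x v by (metis X.vertex_in_space)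
    then have "0 < \<rho>"
      unfolding \<rho>_def using fm by (metis mdist_nonneg mdist_zero order_le_less)
    moreover have "\<rho> \<le> 1"
      unfolding \<rho>_def using Y.mdist_less_1[OF fm] by simp
    ultimately obtain k where k: "1 / s' ^ Suc k < \<rho>" "\<rho> \<le> 1 / s' ^ k"
      by (rule Y.level_of_scale)
    obtain w where w: "w \<in> Y.V" "fst w = k" "mdist m' (snd w) (f ?p) < Y.radius w"
      using Y.vertex_near_point[OF fm(1)] by blast
    have \<rho>: "\<rho> \<le> Y.radius w" "Y.radius w \<le> s' * \<rho>"
      using k w(2) Y.s_gt_1 by (auto simp: Y.radius_def field_simps)
    have "corr B v w"
      unfolding corr_def
    proof (intro bexI conjI)
      show "mdist m ?p ?p \<le> B * X.radius v"
        using v B(1)[of "X.radius v"] X.radius_pos[of v] by (simp add: less_imp_le)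
      show "mdist m ?p x \<le> B * X.radius v"
        using x B(1)[of "X.radius v"] X.radius_pos[of v] by linarith
      have "X.radius v \<le> (1 / l) * mdist m ?p x"
        using x(2) \<open>l > 0\<close> by (simp add: field_simps)
      then show "X.radius v \<le> B * mdist m ?p x"
        using B(4)[of "mdist m ?p x"] by simp
      show "mdist m' (snd w) (f ?p) \<le> B * Y.radius w"
        using w B(1)[of "Y.radius w"] Y.radius_pos[of w] by linarith
      have "mdist m' (snd w) (f x) \<le> mdist m' (snd w) (f ?p) + \<rho>"
        unfolding \<rho>_def using fm w by (intro mdist_triangle) auto
      then show "mdist m' (snd w) (f x) \<le> B * Y.radius w"
        using w(3) \<rho>(1) B(2)[of "Y.radius w"] Y.radius_pos[of w] by linarith
      show "Y.radius w \<le> B * mdist m' (f ?p) (f x)"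
        using \<rho>(2) B(3)[of \<rho>] \<open>0 < \<rho>\<close> unfolding \<rho>_def by linarith
    qed (use v x in auto)
    then show ?thesis
      using w(1) by blast
  qed
  then show ?thesis
    by (rule that)
qed

text \<open>A choice \<open>F\<close> of corresponding vertices has bounded fibres: all vertices that correspond to one vertex
  are near each other, by \<open>corr_coarsely_continuous\<close> for the inverse map. Spreading the fibres over
  the families of \<open>disjoint_near_families\<close> makes the choice injective.\<close>
lemma corr_injection:
  assumes "uniformly_perfect m" "doubling m" "uniformly_perfect m'"
  obtains B i where "inj_on i X.V" "i ` X.V \<subseteq> Y.V" "\<And>v. v \<in> X.V \<Longrightarrow> corr B v (i v)"
proof -
  interpret flip: filling_correspondence m' s' P' m s P g f
    by (rule swap)
  obtain B where "\<And>v. v \<in> X.V \<Longrightarrow> \<exists>w\<in>Y.V. corr B v w"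
    using corr_exists[OF assms(1)] by blast
  then obtain F where F: "\<And>v. v \<in> X.V \<Longrightarrow> F v \<in> Y.V \<and> corr B v (F v)"
    by metis
  obtain M where M: "\<And>w w' v v'. w \<in> Y.V \<Longrightarrow> w' \<in> Y.V \<Longrightarrow> v \<in> X.V \<Longrightarrow> v' \<in> X.V \<Longrightarrow>
      flip.corr B w v \<Longrightarrow> flip.corr B w' v' \<Longrightarrow> Y.near 1 w w' \<Longrightarrow> X.near M v v'"
    using flip.corr_coarsely_continuous[of B 1] by blast
  obtain N where N: "\<And>v. v \<in> X.V \<Longrightarrow> finite {v'\<in>X.V. X.near M v v'} \<and> card {v'\<in>X.V. X.near M v v'} \<le> N"
    using X.near_finite_bounded[OF assms(2)] by blast
  have fibre: "finite {v\<in>X.V. F v = w} \<and> card {v\<in>X.V. F v = w} \<le> N" if w: "w \<in> Y.V" for w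
  proof (cases "{v\<in>X.V. F v = w} = {}")
    case False
    then obtain v where v: "v \<in> X.V" "F v = w"
      by blast
    have "{v\<in>X.V. F v = w} \<subseteq> {v'\<in>X.V. X.near M v v'}"
    proof
      fix v' assume "v' \<in> {v\<in>X.V. F v = w}"
      then have v': "v' \<in> X.V" "F v' = w"
        by auto
      have "flip.corr B w v" "flip.corr B w v'"
        using F[OF v(1)] F[OF v'(1)] v v' corr_swap by auto
      then show "v' \<in> {v'\<in>X.V. X.near M v v'}"
        using M[OF w w v(1) v'(1)] Y.near_refl[OF w] v' by auto
    qed
    then show ?thesis
      using N[OF v(1)] by (meson card_mono finite_subset le_trans)
  next
    case True
    show ?thesis
      unfolding True by simp
  qed
  obtain M' D where D: "\<And>w. w \<in> Y.V \<Longrightarrow> D w \<subseteq> {u\<in>Y.V. Y.near M' w u}"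
    "\<And>w. w \<in> Y.V \<Longrightarrow> finite (D w) \<and> card (D w) = N"
    "\<And>w u. w \<in> Y.V \<Longrightarrow> u \<in> Y.V \<Longrightarrow> w \<noteq> u \<Longrightarrow> D w \<inter> D u = {}"
    by (rule Y.disjoint_near_families[OF assms(3), where N = N]) (rule that)
  have "\<exists>i. inj_on i X.V \<and> (\<forall>v\<in>X.V. i v \<in> D (F v))"
  proof (rule injection_subordinate_to_map[where B = "Y.V" and N = N])
    show "F ` X.V \<subseteq> Y.V"
      using F by blast
  qed (use fibre D in auto)
  then obtain i where i: "inj_on i X.V" "\<And>v. v \<in> X.V \<Longrightarrow> i v \<in> D (F v)"
    by blast
  have iv: "i v \<in> Y.V" "Y.near M' (F v) (i v)" if "v \<in> X.V" for v
    using D(1)[of "F v"] F[OF that] i(2)[OF that] by auto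
  show ?thesis
  proof (rule that[OF i(1)])
    show "corr (M' + B * M') v (i v)" if "v \<in> X.V" for v
      using F[OF that] iv[OF that] that by (intro corr_near[where w = "F v"]) auto
  qed (use iv in auto)
qed

lemma bilipschitz_fillings:
  assumes "uniformly_perfect m" "doubling m" "uniformly_perfect m'" "doubling m'"
  shows "bilipschitz_equivalent (graph_metric X.V X.E) (graph_metric Y.V Y.E)"
proof -
  interpret flip: filling_correspondence m' s' P' m s P g f
    by (rule swap)
  obtain B1 i where i: "inj_on i X.V" "i ` X.V \<subseteq> Y.V" "\<And>v. v \<in> X.V \<Longrightarrow> corr B1 v (i v)"
    using corr_injection assms by metis
  obtain B2 j where j: "inj_on j Y.V" "j ` Y.V \<subseteq> X.V" "\<And>w. w \<in> Y.V \<Longrightarrow> flip.corr B2 w (j w)"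
    using flip.corr_injection assms by metis
  define B where "B = max B1 B2"
  obtain h where h: "bij_betw h X.V Y.V" "\<And>v. v \<in> X.V \<Longrightarrow> h v = i v \<or> j (h v) = v"
    using Schroeder_Bernstein_pointwise[OF i(1,2) j(1,2)] by blast
  have hV: "h v \<in> Y.V" if "v \<in> X.V" for v
    using h(1) that by (rule bij_betw_apply)
  have corr: "corr B v (h v)" if v: "v \<in> X.V" for v
    using h(2)[OF v]
  proof
    assume "h v = i v"
    then show ?thesis
      using i(3)[OF v] corr_mono by (simp add: B_def)
  next
    assume "j (h v) = v"
    then have "corr B2 v (h v)"
      using flip.corr_swap[OF j(3)[OF hV[OF v]]] by simp
    then show ?thesis
      using corr_mono by (simp add: B_def)
  qed
  then have corr': "flip.corr B (h v) v" if "v \<in> X.V" for v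
    using that corr_swap by blast
  show ?thesis
  proof (rule bilipschitz_equivalent_fillingsI[OF X.filling_nets_axioms Y.filling_nets_axioms h(1)])
    show "\<exists>M'. \<forall>v\<in>X.V. \<forall>w\<in>X.V. X.near M v w \<longrightarrow> Y.near M' (h v) (h w)" for M
      using corr_coarsely_continuous[of B M] corr hV by metis
    show "\<exists>M'. \<forall>v\<in>X.V. \<forall>w\<in>X.V. Y.near M (h v) (h w) \<longrightarrow> X.near M' v w" for M
      using flip.corr_coarsely_continuous[of B M] corr' hV by metis
  qed
qed

end

text \<open>Each level has at most one vertex, and nearness only compares levels.\<close>
lemma (in filling_correspondence) bilipschitz_fillings_of_point:
  assumes one: "\<And>x y. x \<in> mspace m \<Longrightarrow> y \<in> mspace m \<Longrightarrow> x = y"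
  shows "bilipschitz_equivalent (graph_metric X.V X.E) (graph_metric Y.V Y.E)"
proof -
  have one': "x = y" if "x \<in> mspace m'" "y \<in> mspace m'" for x y
    using one g that by metis
  define h where "h v = (fst v, f (snd v))" for v :: "nat \<times> 'a"
  have hV: "h v \<in> Y.V" if v: "v \<in> X.V" for v
  proof -
    have "f (snd v) \<in> mspace m'"
      using f v by simp
    then obtain w where w: "w \<in> Y.V" "fst w = fst v"
      using Y.vertex_near_point by blast
    then have "w = h v"
      using one'[of "snd w" "f (snd v)"] \<open>f (snd v) \<in> mspace m'\<close> by (simp add: h_def prod_eq_iff)
    then show ?thesis
      using w by simp
  qed
  have "inj_on h X.V"
  proof (rule inj_onI)
    fix v w assume "v \<in> X.V" "w \<in> X.V" "h v = h w"
    then show "v = w"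
      using one[of "snd v" "snd w"] by (simp add: h_def prod_eq_iff)
  qed
  moreover have "w \<in> h ` X.V" if w: "w \<in> Y.V" for w
  proof -
    have "g (snd w) \<in> mspace m"
      using g w by simp
    then obtain v where v: "v \<in> X.V" "fst v = fst w"
      using X.vertex_near_point by blast
    then have "h v = w"
      using one'[of "f (snd v)" "snd w"] f w by (simp add: h_def prod_eq_iff)
    then show ?thesis
      using v by blast
  qed
  ultimately have h: "bij_betw h X.V Y.V"
    using hV by (auto simp: bij_betw_def)
  show ?thesis
  proof (rule bilipschitz_equivalent_fillingsI[OF X.filling_nets_axioms Y.filling_nets_axioms h])
    fix M
    obtain a where "M \<le> s ^ a" and a: "\<And>v w. X.radius v \<le> M * X.radius w \<Longrightarrow> fst w \<le> fst v + a"
      using X.level_diff_of_radius[of M] by blast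
    have "Y.near (s' ^ a) (h v) (h w)" if vw: "v \<in> X.V" "w \<in> X.V" "X.near M v w" for v w
    proof -
      have "snd (h v) = snd (h w)"
        using one' vw hV by simp
      moreover have "fst w \<le> fst v + a" "fst v \<le> fst w + a"
        using a vw(3) by (auto simp: X.near_def)
      then have "Y.radius (h v) \<le> s' ^ a * Y.radius (h w)" "Y.radius (h w) \<le> s' ^ a * Y.radius (h v)"
        by (auto intro!: Y.radius_le_of_level_le simp: h_def)
      ultimately show ?thesis
        using vw hV Y.s_gt_1 by (simp add: Y.near_def less_imp_le)
    qed
    then show "\<exists>M'. \<forall>v\<in>X.V. \<forall>w\<in>X.V. X.near M v w \<longrightarrow> Y.near M' (h v) (h w)"
      by blast
  next
    fix M
    obtain a where "M \<le> s' ^ a" and a: "\<And>v w. Y.radius v \<le> M * Y.radius w \<Longrightarrow> fst w \<le> fst v + a"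
      using Y.level_diff_of_radius[of M] by blast
    have "X.near (s ^ a) v w" if vw: "v \<in> X.V" "w \<in> X.V" "Y.near M (h v) (h w)" for v w
    proof -
      have "snd v = snd w"
        using one vw by simp
      moreover have "fst w \<le> fst v + a" "fst v \<le> fst w + a"
        using a[of "h v" "h w"] a[of "h w" "h v"] vw(3) by (auto simp: Y.near_def h_def)
      then have "X.radius v \<le> s ^ a * X.radius w" "X.radius w \<le> s ^ a * X.radius v"
        by (auto intro!: X.radius_le_of_level_le)
      ultimately show ?thesis
        using vw X.s_gt_1 by (simp add: X.near_def less_imp_le)
    qed
    then show "\<exists>M'. \<forall>v\<in>X.V. \<forall>w\<in>X.V. Y.near M (h v) (h w) \<longrightarrow> X.near M' v w"
      by blast
  qed
qed

section \<open>Ahlfors regular spaces\<close>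

lemma separated_set_scaled [simp]:
  "c > 0 \<Longrightarrow> separated_set (scaled_metric c m) r S \<longleftrightarrow> separated_set m (r / c) S"
  by (simp add: separated_set_def field_simps)

lemma doubling_scaled:
  assumes "doubling m" "c > 0"
  shows "doubling (scaled_metric c m)"
  unfolding doubling_def
proof
  fix M
  obtain N where N: "\<forall>x\<in>mspace m. \<forall>r>0. \<forall>S. separated_set m r S \<and> (\<forall>y\<in>S. mdist m x y \<le> M * r) \<longrightarrow>
      finite S \<and> card S \<le> N"
    using assms(1) unfolding doubling_def by blast
  have "finite S \<and> card S \<le> N"
    if "x \<in> mspace m" "r > 0" "separated_set m (r / c) S" "\<forall>y\<in>S. c * mdist m x y \<le> M * r" for x r S
    using that \<open>c > 0\<close> by (intro N[rule_format, of x "r / c"]) (auto simp: field_simps)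
  then show "\<exists>N. \<forall>x\<in>mspace (scaled_metric c m). \<forall>r>0. \<forall>S. separated_set (scaled_metric c m) r S \<and>
      (\<forall>y\<in>S. mdist (scaled_metric c m) x y \<le> M * r) \<longrightarrow> finite S \<and> card S \<le> N"
    using \<open>c > 0\<close> by (intro exI[of _ N]) simp
qed

lemma uniformly_perfect_scaled:
  assumes "uniformly_perfect m" "c > 0"
  shows "uniformly_perfect (scaled_metric c m)"
  unfolding uniformly_perfect_def
proof (intro allI impI)
  fix R :: real assume "R > 0"
  then obtain l where "l > 0" and l: "\<And>x r. x \<in> mspace m \<Longrightarrow> 0 < r \<Longrightarrow> r \<le> R / c \<Longrightarrow>
      \<exists>y\<in>mspace m. l * r \<le> mdist m x y \<and> mdist m x y < r"
    using assms unfolding uniformly_perfect_def by (metis divide_pos_pos)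
  have "\<exists>y\<in>mspace m. l * r \<le> c * mdist m x y \<and> c * mdist m x y < r"
    if "x \<in> mspace m" "0 < r" "r \<le> R" for x r
    using l[of x "r / c"] that \<open>c > 0\<close> by (auto simp: field_simps)
  then show "\<exists>l>0. \<forall>x\<in>mspace (scaled_metric c m). \<forall>r. 0 < r \<and> r \<le> R \<longrightarrow>
      (\<exists>y\<in>mspace (scaled_metric c m). l * r \<le> mdist (scaled_metric c m) x y \<and> mdist (scaled_metric c m) x y < r)"
    using \<open>c > 0\<close> \<open>l > 0\<close> by (intro exI[of _ l]) simp
qed

lemma controls_ratios_scaled:
  assumes "controls_ratios m m' f" "c > 0" "c' > 0"
  shows "controls_ratios (scaled_metric c m) (scaled_metric c' m') f"
proof -
  have "c * t \<le> C * (c * u) \<longleftrightarrow> t \<le> C * u" "c' * t \<le> C * (c' * u) \<longleftrightarrow> t \<le> C * u" for t u C :: real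
    using assms(2,3) by (simp_all add: mult.left_commute)
  then show ?thesis
    using assms by (simp add: controls_ratios_def)
qed

lemma hausdorff_content_mono:
  "A \<subseteq> B \<Longrightarrow> hausdorff_content m Q \<delta> A \<le> hausdorff_content m Q \<delta> B"
  unfolding hausdorff_content_def by (rule INF_superset_mono) auto

lemma hausdorff_content_antimono_scale:
  assumes "\<delta> \<le> \<delta>'"
  shows "hausdorff_content m Q \<delta>' A \<le> hausdorff_content m Q \<delta> A"
proof -
  have "ennreal \<delta> \<le> ennreal \<delta>'"
    using assms by (rule ennreal_leI)
  then show ?thesis
    unfolding hausdorff_content_def by (intro INF_superset_mono) (auto intro: order_trans)
qed

text \<open>A covering set of diameter at most \<open>\<delta>\<close> meets at most one of the sets \<open>A i\<close>, so a covering of the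
  union splits into coverings of the pieces that share no terms. This replaces countable additivity,
  and with it any question of measurability, in counting balls at positive distance.\<close>
lemma hausdorff_content_superadditive:
  assumes "finite T" "0 \<le> \<delta>"
    and apart: "\<And>i j x y. i \<in> T \<Longrightarrow> j \<in> T \<Longrightarrow> i \<noteq> j \<Longrightarrow> x \<in> A i \<Longrightarrow> y \<in> A j \<Longrightarrow> \<delta> < mdist m x y"
  shows "(\<Sum>i\<in>T. hausdorff_content m Q \<delta> (A i)) \<le> hausdorff_content m Q \<delta> (\<Union>i\<in>T. A i)"
proof -
  define w where "w S = ennreal (enn2real (mdiameter m S) powr Q)" for S
  have w_empty: "w {} = 0"
    by (simp add: w_def mdiameter_def bot_ennreal)
  have "(\<Sum>i\<in>T. hausdorff_content m Q \<delta> (A i)) \<le> (\<Sum>j. w (U j))"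
    if U: "\<And>j. U j \<subseteq> mspace m \<and> mdiameter m (U j) \<le> ennreal \<delta>" "(\<Union>i\<in>T. A i) \<subseteq> (\<Union>j. U j)"
    for U
  proof -
    define R where "R i j = (if U j \<inter> A i \<noteq> {} then U j else {})" for i j
    have "hausdorff_content m Q \<delta> (A i) \<le> (\<Sum>j. w (R i j))" if "i \<in> T" for i
      unfolding hausdorff_content_def w_def
    proof (rule INF_lower)
      have "A i \<subseteq> (\<Union>j. R i j)"
        using U(2) that by (force simp: R_def)
      then show "R i \<in> {U. (\<forall>j. U j \<subseteq> mspace m \<and> mdiameter m (U j) \<le> ennreal \<delta>) \<and> A i \<subseteq> (\<Union>j. U j)}"
        using U(1) by (auto simp: R_def mdiameter_def)
    qed
    then have "(\<Sum>i\<in>T. hausdorff_content m Q \<delta> (A i)) \<le> (\<Sum>i\<in>T. \<Sum>j. w (R i j))"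
      by (rule sum_mono)
    also have "\<dots> = (\<Sum>j. \<Sum>i\<in>T. w (R i j))"
      by (rule suminf_sum[symmetric]) simp
    also have "\<dots> \<le> (\<Sum>j. w (U j))"
    proof (rule suminf_le)
      fix j
      show "(\<Sum>i\<in>T. w (R i j)) \<le> w (U j)"
      proof (cases "\<exists>i\<in>T. U j \<inter> A i \<noteq> {}")
        case True
        then obtain i x where i: "i \<in> T" "x \<in> U j" "x \<in> A i"
          by blast
        have "R k j = {}" if "k \<in> T - {i}" for k
        proof (rule ccontr)
          assume "R k j \<noteq> {}"
          then obtain y where y: "y \<in> U j" "y \<in> A k"
            by (auto simp: R_def split: if_splits)
          have "ennreal (mdist m x y) \<le> ennreal \<delta>"
            using mdist_le_mdiameter[OF i(2) y(1)] U(1) by (meson order_trans)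
          moreover have "\<delta> < mdist m x y"
            using apart[of i k x y] i y that by auto
          ultimately show False
            using \<open>0 \<le> \<delta>\<close> by simp
        qed
        then have "(\<Sum>k\<in>T. w (R k j)) = w (R i j)"
          using \<open>finite T\<close> i(1) by (simp add: sum.remove[of T i] w_empty)
        then show ?thesis
          by (simp add: R_def w_empty)
      next
        case False
        then have "w (R k j) = 0" if "k \<in> T" for k
          using that by (simp add: R_def w_empty)
        then show ?thesis
          by simp
      qed
    qed simp_all
    finally show ?thesis .
  qed
  then show ?thesis
    unfolding hausdorff_content_def[of m Q \<delta> "\<Union>i\<in>T. A i"] w_def[symmetric]
    by (intro INF_greatest) auto
qed

lemma compact_separated_card_bounded:
  assumes "compact_space (mtopology_of m)" "\<epsilon> > 0"
  obtains N where "\<And>S. separated_set m \<epsilon> S \<Longrightarrow> finite S \<and> card S \<le> N"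
proof -
  interpret Metric_space "mspace m" "mdist m"
    by simp
  have "mtotally_bounded (mspace m)"
    using assms(1) by (simp add: mtopology_of_def compact_space_eq_mcomplete_mtotally_bounded)
  then obtain K where K: "finite K" "K \<subseteq> mspace m" "mspace m \<subseteq> (\<Union>x\<in>K. mball x (\<epsilon> / 2))"
    using \<open>\<epsilon> > 0\<close> unfolding mtotally_bounded_def by (meson half_gt_zero)
  have "finite S \<and> card S \<le> card K" if S: "separated_set m \<epsilon> S" for S
  proof -
    have "\<exists>k\<in>K. mdist m k x < \<epsilon> / 2" if "x \<in> S" for x
      using K(3) S that by (fastforce simp: separated_set_def)
    then obtain q where q: "\<And>x. x \<in> S \<Longrightarrow> q x \<in> K \<and> mdist m (q x) x < \<epsilon> / 2"
      by metis
    have "inj_on q S"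
    proof (rule inj_onI, rule ccontr)
      fix x y assume xy: "x \<in> S" "y \<in> S" "q x = q y" "x \<noteq> y"
      then have "\<epsilon> \<le> mdist m x y"
        using S by (simp add: separated_set_def)
      also have "\<dots> \<le> mdist m x (q x) + mdist m (q x) y"
        using S xy q K(2) by (intro mdist_triangle) (auto simp: separated_set_def)
      also have "\<dots> < \<epsilon>"
        using q[OF xy(1)] q[OF xy(2)] xy(3) by (simp add: mdist_commute)
      finally show False
        by simp
    qed
    moreover have "q ` S \<subseteq> K"
      using q by auto
    ultimately show ?thesis
      using K(1) by (meson card_inj_on_le inj_on_finite)
  qed
  then show ?thesis
    by (rule that)
qed

text \<open>If the annulus between radii \<open>l * \<rho>\<close> and \<open>\<rho>\<close> is empty, then the two balls coincide, and the
  bounds on their measure give \<open>c \<le> C * l powr Q\<close>, which fails for small \<open>l\<close>. The factor \<open>t\<close> brings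
  scales up to \<open>R\<close> below the diameter, where the bounds on the measure hold.\<close>
lemma ahlfors_regular_uniformly_perfect:
  assumes "ahlfors_regular m" "x0 \<in> mspace m" "y0 \<in> mspace m" "x0 \<noteq> y0"
  shows "uniformly_perfect m"
  unfolding uniformly_perfect_def
proof (intro allI impI)
  fix R :: real assume "R > 0"
  obtain Q c C where Q: "Q > 0" "c > 0" "C > 0" and
    reg: "\<And>x r. x \<in> mspace m \<Longrightarrow> 0 < r \<Longrightarrow> ennreal r \<le> mdiameter m (mspace m) \<Longrightarrow>
        ennreal (c * r powr Q) \<le> hausdorff_measure m Q (mball_of m x r) \<and>
        hausdorff_measure m Q (mball_of m x r) \<le> ennreal (C * r powr Q)"
    using assms(1) unfolding ahlfors_regular_def ahlfors_regular_dim_def by blast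
  define d where "d = mdist m x0 y0"
  have "d > 0"
    using assms by (simp add: d_def order_less_le)
  have scale: "ennreal r \<le> mdiameter m (mspace m)" if "r \<le> d" for r
    using mdist_le_mdiameter[OF assms(2,3)] that unfolding d_def by (meson ennreal_leI order_trans)
  define l where "l = min 1 ((c / (2 * C)) powr (1 / Q))"
  have l: "0 < l" "l \<le> 1"
    using Q by (auto simp: l_def)
  have "l powr Q \<le> ((c / (2 * C)) powr (1 / Q)) powr Q"
    using Q l by (intro powr_mono2) (auto simp: l_def)
  also have "\<dots> = c / (2 * C)"
    using Q by (simp add: powr_powr)
  finally have lQ: "C * l powr Q \<le> c / 2"
    using Q by (simp add: field_simps)
  define t where "t = min 1 (d / R)"
  have t: "0 < t" "t \<le> 1"
    using \<open>d > 0\<close> \<open>R > 0\<close> by (auto simp: t_def)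
  have "\<exists>y\<in>mspace m. l * t * r \<le> mdist m x y \<and> mdist m x y < r"
    if x: "x \<in> mspace m" and r: "0 < r" "r \<le> R" for x r
  proof -
    define \<rho> where "\<rho> = t * r"
    have "t * r \<le> (d / R) * R"
      using r t \<open>d > 0\<close> \<open>R > 0\<close> by (intro mult_mono) (auto simp: t_def)
    moreover have "t * r \<le> 1 * r"
      using r t by (intro mult_right_mono) auto
    ultimately have \<rho>: "0 < \<rho>" "\<rho> \<le> d" "\<rho> \<le> r"
      using r t \<open>R > 0\<close> by (auto simp: \<rho>_def)
    have "l * \<rho> \<le> 1 * \<rho>"
      using l \<rho> by (intro mult_right_mono) auto
    then have l\<rho>: "0 < l * \<rho>" "l * \<rho> \<le> d"
      using l \<rho> mult_pos_pos[of l \<rho>] by linarith+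
    have "\<exists>y\<in>mspace m. l * \<rho> \<le> mdist m x y \<and> mdist m x y < \<rho>"
    proof (rule ccontr)
      assume "\<not> ?thesis"
      then have "mball_of m x \<rho> \<subseteq> mball_of m x (l * \<rho>)"
        by (auto simp: not_le)
      moreover have "mball_of m x (l * \<rho>) \<subseteq> mball_of m x \<rho>"
        using \<open>l * \<rho> \<le> 1 * \<rho>\<close> by auto
      ultimately have "mball_of m x \<rho> = mball_of m x (l * \<rho>)"
        by blast
      then have "ennreal (c * \<rho> powr Q) \<le> ennreal (C * (l * \<rho>) powr Q)"
        using reg[OF x \<rho>(1) scale[OF \<rho>(2)]] reg[OF x l\<rho>(1) scale[OF l\<rho>(2)]]
        by (metis order_trans)
      then have "c * \<rho> powr Q \<le> (C * l powr Q) * \<rho> powr Q"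
        using Q l \<rho> by (simp add: powr_mult)
      also have "\<dots> \<le> (c / 2) * \<rho> powr Q"
        using lQ by (intro mult_right_mono) auto
      finally show False
        using Q \<rho> by simp
    qed
    then show ?thesis
      using \<rho>(3) unfolding \<rho>_def by (auto simp: mult.assoc intro: order_less_le_trans)
  qed
  then show "\<exists>l>0. \<forall>x\<in>mspace m. \<forall>r. 0 < r \<and> r \<le> R \<longrightarrow>
      (\<exists>y\<in>mspace m. l * r \<le> mdist m x y \<and> mdist m x y < r)"
    using l t by (intro exI[of _ "l * t"]) auto
qed

text \<open>The balls of radius \<open>r / 4\<close> around the points of \<open>T\<close> have measure at least \<open>c * (r / 4) powr Q\<close>
  and fit into a ball of radius \<open>(M + 1) * r\<close>. They are at positive distance from each other, so
  their contents at a small scale \<open>\<delta>\<close> add up; the factor \<open>2\<close> pays for the passage from the measure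
  to the content at such a scale.\<close>
lemma ahlfors_regular_separated_card:
  assumes "Q > 0" "c > 0" "C > 0" and
    reg: "\<And>x r. x \<in> mspace m \<Longrightarrow> 0 < r \<Longrightarrow> ennreal r \<le> mdiameter m (mspace m) \<Longrightarrow>
        ennreal (c * r powr Q) \<le> hausdorff_measure m Q (mball_of m x r) \<and>
        hausdorff_measure m Q (mball_of m x r) \<le> ennreal (C * r powr Q)"
    and "x \<in> mspace m" "0 \<le> M" "0 < r" "ennreal ((M + 1) * r) \<le> mdiameter m (mspace m)"
    and T: "finite T" "separated_set m r T" "\<And>y. y \<in> T \<Longrightarrow> mdist m x y \<le> M * r"
  shows "real (card T) \<le> 2 * C * (4 * (M + 1)) powr Q / c"
proof -
  define a where "a = c / 2 * (r / 4) powr Q"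
  have "a > 0"
    using assms by (simp add: a_def)
  define B where "B t = mball_of m t (r / 4)" for t
  have T_sub: "T \<subseteq> mspace m"
    using T(2) by (simp add: separated_set_def)
  have "r / 4 \<le> (M + 1) * r"
    using \<open>0 \<le> M\<close> \<open>0 < r\<close> mult_right_mono[of 1 "M + 1" r] by simp
  then have small: "ennreal (r / 4) \<le> mdiameter m (mspace m)"
    using assms(8) by (meson ennreal_leI order_trans)
  have "\<exists>\<delta>>0. ennreal a < hausdorff_content m Q \<delta> (B t)" if "t \<in> T" for t
  proof -
    have "ennreal a < ennreal (c * (r / 4) powr Q)"
      using \<open>a > 0\<close> assms by (simp add: ennreal_less_iff a_def)
    also have "\<dots> \<le> hausdorff_measure m Q (B t)"
      unfolding B_def using reg[of t "r / 4"] small T_sub that \<open>0 < r\<close> by auto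
    finally show ?thesis
      by (auto simp: hausdorff_measure_def less_SUP_iff)
  qed
  then obtain e where e: "\<And>t. t \<in> T \<Longrightarrow> e t > 0 \<and> ennreal a < hausdorff_content m Q (e t) (B t)"
    by metis
  define \<delta> where "\<delta> = Min (insert (r / 4) (e ` T))"
  have "0 < \<delta>"
    using T(1) e \<open>0 < r\<close> by (auto simp: \<delta>_def)
  have "\<delta> \<le> r / 4"
    using T(1) unfolding \<delta>_def by (intro Min_le) auto
  have content: "ennreal a \<le> hausdorff_content m Q \<delta> (B t)" if "t \<in> T" for t
  proof -
    have "\<delta> \<le> e t"
      using T(1) that by (auto simp: \<delta>_def)
    then show ?thesis
      using e[OF that] hausdorff_content_antimono_scale by (meson less_imp_le order_trans)
  qed
  have apart: "\<delta> < mdist m y z"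
    if "t \<in> T" "u \<in> T" "t \<noteq> u" "y \<in> B t" "z \<in> B u" for t u y z
  proof -
    have "r \<le> mdist m t u"
      using T(2) that by (simp add: separated_set_def)
    also have "\<dots> \<le> mdist m t y + (mdist m y z + mdist m z u)"
      using mdist_triangle[of t m y u] mdist_triangle[of y m z u] that by (auto simp: B_def)
    also have "\<dots> < r / 4 + (mdist m y z + r / 4)"
      using that by (auto simp: B_def mdist_commute intro!: add_strict_mono)
    finally show ?thesis
      using \<open>\<delta> \<le> r / 4\<close> \<open>0 < r\<close> by linarith
  qed
  have "(\<Union>t\<in>T. B t) \<subseteq> mball_of m x ((M + 1) * r)"
  proof
    fix y assume "y \<in> (\<Union>t\<in>T. B t)"
    then obtain t where t: "t \<in> T" "y \<in> mspace m" "t \<in> mspace m" "mdist m t y < r / 4"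
      by (auto simp: B_def)
    then have "mdist m x y < M * r + r"
      using mdist_triangle[of x m t y] T(3)[of t] \<open>x \<in> mspace m\<close> \<open>0 < r\<close> by auto
    then show "y \<in> mball_of m x ((M + 1) * r)"
      using t \<open>x \<in> mspace m\<close> by (simp add: algebra_simps)
  qed
  have "ennreal (real (card T) * a) = (\<Sum>t\<in>T. ennreal a)"
    using \<open>a > 0\<close> by (simp add: ennreal_mult ennreal_of_nat_eq_real_of_nat)
  also have "\<dots> \<le> (\<Sum>t\<in>T. hausdorff_content m Q \<delta> (B t))"
    using content by (rule sum_mono)
  also have "\<dots> \<le> hausdorff_content m Q \<delta> (\<Union>t\<in>T. B t)"
    using T(1) \<open>0 < \<delta>\<close> apart by (intro hausdorff_content_superadditive) auto
  also have "\<dots> \<le> hausdorff_content m Q \<delta> (mball_of m x ((M + 1) * r))"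
    by (rule hausdorff_content_mono) fact
  also have "\<dots> \<le> hausdorff_measure m Q (mball_of m x ((M + 1) * r))"
    unfolding hausdorff_measure_def using \<open>0 < \<delta>\<close> by (intro SUP_upper) simp
  also have "\<dots> \<le> ennreal (C * ((M + 1) * r) powr Q)"
    using reg[of x "(M + 1) * r"] assms by auto
  finally have "real (card T) * a \<le> C * ((M + 1) * r) powr Q"
    using assms by simp
  also have "\<dots> = C * (4 * (M + 1)) powr Q * (r / 4) powr Q"
  proof -
    have "(M + 1) * r = (4 * (M + 1)) * (r / 4)"
      by simp
    then have "((M + 1) * r) powr Q = (4 * (M + 1)) powr Q * (r / 4) powr Q"
      using powr_mult[of "4 * (M + 1)" "r / 4" Q] by metis
    then show ?thesis
      by simp
  qed
  finally have "real (card T) * (c / 2) * (r / 4) powr Q \<le> C * (4 * (M + 1)) powr Q * (r / 4) powr Q"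
    by (simp add: a_def mult.assoc)
  then have "real (card T) * (c / 2) \<le> C * (4 * (M + 1)) powr Q"
    using \<open>0 < r\<close> by simp
  then show ?thesis
    using \<open>c > 0\<close> by (simp add: field_simps)
qed

text \<open>Counting by measure works for scales up to the diameter. At larger scales the sets are separated by
  a fixed amount, and compactness bounds their size.\<close>
lemma compact_ahlfors_regular_doubling:
  assumes "compact_space (mtopology_of m)" "ahlfors_regular m"
    and "x0 \<in> mspace m" "y0 \<in> mspace m" "x0 \<noteq> y0"
  shows "doubling m"
  unfolding doubling_def
proof
  fix M0 :: real
  obtain Q c C where Q: "Q > 0" "c > 0" "C > 0" and
    reg: "\<And>x r. x \<in> mspace m \<Longrightarrow> 0 < r \<Longrightarrow> ennreal r \<le> mdiameter m (mspace m) \<Longrightarrow>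
        ennreal (c * r powr Q) \<le> hausdorff_measure m Q (mball_of m x r) \<and>
        hausdorff_measure m Q (mball_of m x r) \<le> ennreal (C * r powr Q)"
    using assms(2) unfolding ahlfors_regular_def ahlfors_regular_dim_def by blast
  define M where "M = max M0 0"
  define d where "d = mdist m x0 y0"
  have "d > 0"
    using assms by (simp add: d_def order_less_le)
  have "0 \<le> M"
    by (simp add: M_def)
  then have "d / (M + 1) > 0"
    using \<open>d > 0\<close> by simp
  then obtain N1 where N1: "\<And>S. separated_set m (d / (M + 1)) S \<Longrightarrow> finite S \<and> card S \<le> N1"
    using compact_separated_card_bounded[OF assms(1)] by blast
  define N2 where "N2 = nat \<lfloor>2 * C * (4 * (M + 1)) powr Q / c\<rfloor>"
  have "finite S \<and> card S \<le> max N1 N2"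
    if x: "x \<in> mspace m" and r: "0 < r" and S: "separated_set m r S" "\<And>y. y \<in> S \<Longrightarrow> mdist m x y \<le> M0 * r"
    for x r S
  proof (cases "(M + 1) * r \<le> d")
    case True
    then have scale: "ennreal ((M + 1) * r) \<le> mdiameter m (mspace m)"
      using mdist_le_mdiameter[OF assms(3,4)] unfolding d_def by (meson ennreal_leI order_trans)
    have "M0 * r \<le> M * r"
      using r by (intro mult_right_mono) (auto simp: M_def)
    then have SM: "mdist m x y \<le> M * r" if "y \<in> S" for y
      using S(2)[OF that] by linarith
    have "card T \<le> N2" if T: "T \<subseteq> S" "finite T" for T
    proof -
      have "separated_set m r T"
        using S(1) T by (auto simp: separated_set_def)
      then have "real (card T) \<le> 2 * C * (4 * (M + 1)) powr Q / c"
        using T SM by (intro ahlfors_regular_separated_card[OF Q reg x \<open>0 \<le> M\<close> r scale]) auto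
      then show ?thesis
        unfolding N2_def by (simp add: le_nat_floor)
    qed
    then have "finite S \<and> card S \<le> N2"
      by (rule finite_if_finite_subsets_card_bdd)
    then show ?thesis
      by (simp add: le_max_iff_disj)
  next
    case False
    then have "d / (M + 1) \<le> r"
      using \<open>0 \<le> M\<close> by (simp add: field_simps)
    then have "separated_set m (d / (M + 1)) S"
      using S(1) unfolding separated_set_def by (meson order_trans)
    then show ?thesis
      using N1[of S] by (simp add: le_max_iff_disj)
  qed
  then show "\<exists>N. \<forall>x\<in>mspace m. \<forall>r>0. \<forall>S. separated_set m r S \<and> (\<forall>y\<in>S. mdist m x y \<le> M0 * r) \<longrightarrow>
      finite S \<and> card S \<le> N"
    by (intro exI[of _ "max N1 N2"]) auto
qed

section \<open>Quasisymmetries\<close>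

text \<open>A continuous injection on the half line is monotone, and it cannot be decreasing because it would
  then be bounded by its value at \<open>0\<close>.\<close>
lemma homeomorphism_half_line:
  assumes "homeomorphic_map (top_of_set {0..}) (top_of_set {0..}) (\<eta> :: real \<Rightarrow> real)"
  shows "continuous_on {0..} \<eta>" "\<eta> 0 = 0"
proof -
  show cont: "continuous_on {0..} \<eta>"
    using homeomorphic_imp_continuous_map[OF assms] by (simp add: continuous_map_in_subtopology)
  have surj: "\<eta> ` {0..} = {0..}"
    using homeomorphic_imp_surjective_map[OF assms] by simp
  have "inj_on \<eta> {0..}"
    using homeomorphic_imp_injective_map[OF assms] by simp
  then have "strict_mono_on {0..} \<eta> \<or> strict_antimono_on {0..} \<eta>"
    using injective_eq_monotone_map[of "{0..}" \<eta>] cont by (simp add: is_interval_ci)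
  then show "\<eta> 0 = 0"
  proof
    assume mono: "strict_mono_on {0..} \<eta>"
    obtain t where "t \<ge> 0" "\<eta> t = 0"
      using surj by (metis atLeast_iff imageE order_refl)
    moreover have "\<eta> 0 \<ge> 0"
      using surj by auto
    ultimately show ?thesis
      using monotone_onD[OF mono, of 0 t] by (cases "t = 0") auto
  next
    assume anti: "strict_antimono_on {0..} \<eta>"
    have "\<eta> 0 \<ge> 0"
      using surj by auto
    then obtain t where "t \<ge> 0" "\<eta> t = \<eta> 0 + 1"
      using surj by (metis add_increasing2 atLeast_iff imageE zero_le_one)
    then show ?thesis
      using monotone_onD[OF anti, of 0 t] by (cases "t = 0") auto
  qed
qed

text \<open>For \<open>f\<close>, use that \<open>\<eta>\<close> is bounded on bounded intervals. For the inverse, use that \<open>\<eta>\<close> is small near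
  \<open>0\<close>: if an image ratio is not small, then neither is the original ratio, and the reciprocal of the
  latter is what has to be bounded.\<close>
lemma quasisymmetry_controls_ratios:
  assumes "quasisymmetry X Y f"
  obtains g where "\<And>x. x \<in> mspace X \<Longrightarrow> f x \<in> mspace Y \<and> g (f x) = x"
    "\<And>y. y \<in> mspace Y \<Longrightarrow> g y \<in> mspace X \<and> f (g y) = y"
    "controls_ratios X Y f" "controls_ratios Y X g"
proof -
  obtain \<eta> :: "real \<Rightarrow> real" where homeo: "homeomorphic_map (mtopology_of X) (mtopology_of Y) f"
    and eta: "homeomorphic_map (top_of_set {0..}) (top_of_set {0..}) \<eta>"
    and qs: "\<And>x y z. x \<in> mspace X \<Longrightarrow> y \<in> mspace X \<Longrightarrow> z \<in> mspace X \<Longrightarrow> x \<noteq> z \<Longrightarrow>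
        mdist Y (f x) (f y) / mdist Y (f x) (f z) \<le> \<eta> (mdist X x y / mdist X x z)"
    using assms unfolding quasisymmetry_def by blast
  have cont: "continuous_on {0..} \<eta>" and eta_0: "\<eta> 0 = 0"
    using homeomorphism_half_line[OF eta] by auto
  have bij: "bij_betw f (mspace X) (mspace Y)"
    using homeomorphic_imp_surjective_map[OF homeo] homeomorphic_imp_injective_map[OF homeo]
    by (simp add: bij_betw_def)
  define g where "g = inv_into (mspace X) f"
  have f: "f x \<in> mspace Y \<and> g (f x) = x" if "x \<in> mspace X" for x
    using bij that by (simp add: g_def bij_betw_apply bij_betw_inv_into_left)
  have g: "g y \<in> mspace X \<and> f (g y) = y" if "y \<in> mspace Y" for y
    using bij bij_betw_inv_into[OF bij] that
    by (simp add: g_def bij_betw_apply bij_betw_inv_into_right)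
  have "controls_ratios X Y f"
    unfolding controls_ratios_def
  proof (intro allI)
    fix C :: real
    define C1 where "C1 = max C 0"
    have "compact (\<eta> ` {0..C1})"
      by (intro compact_continuous_image continuous_on_subset[OF cont]) auto
    then have "bdd_above (\<eta> ` {0..C1})"
      by (intro bounded_imp_bdd_above compact_imp_bounded)
    then obtain b where "\<forall>u\<in>\<eta> ` {0..C1}. u \<le> b"
      unfolding bdd_above_def by blast
    then have b: "\<eta> t \<le> b" if "0 \<le> t" "t \<le> C1" for t
      using that by simp
    have "mdist Y (f x) (f y) \<le> b * mdist Y (f x) (f z)"
      if xyz: "x \<in> mspace X" "y \<in> mspace X" "z \<in> mspace X" and le: "mdist X x y \<le> C * mdist X x z" for x y z
    proof (cases "x = z")
      case True
      then have "mdist X x y = 0"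
        using le xyz by (intro antisym) auto
      then show ?thesis
        using True f xyz by simp
    next
      case False
      have X_pos: "0 < mdist X x z"
        using xyz False by (simp add: order_less_le)
      have "f x \<noteq> f z"
        using f xyz False by metis
      then have Y_pos: "0 < mdist Y (f x) (f z)"
        using f xyz by (simp add: order_less_le)
      have "mdist X x y / mdist X x z \<le> C"
        using le X_pos by (simp add: field_simps)
      then have "\<eta> (mdist X x y / mdist X x z) \<le> b"
        using X_pos by (intro b) (auto simp: C1_def)
      then have "mdist Y (f x) (f y) / mdist Y (f x) (f z) \<le> b"
        using qs[OF xyz False] by linarith
      then show ?thesis
        using Y_pos by (simp add: field_simps)
    qed
    then show "\<exists>C'. \<forall>x\<in>mspace X. \<forall>y\<in>mspace X. \<forall>z\<in>mspace X. mdist X x y \<le> C * mdist X x z \<longrightarrow>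
        mdist Y (f x) (f y) \<le> C' * mdist Y (f x) (f z)"
      by blast
  qed
  moreover have "controls_ratios Y X g"
    unfolding controls_ratios_def
  proof (intro allI)
    fix C :: real
    define C1 where "C1 = max C 1"
    have "1 / C1 > 0"
      by (simp add: C1_def)
    then obtain \<delta> where "\<delta> > 0" and close: "\<forall>t\<in>{0..}. dist t 0 < \<delta> \<longrightarrow> dist (\<eta> t) (\<eta> 0) < 1 / C1"
      using cont unfolding continuous_on_iff by (meson atLeast_iff order_refl)
    then have \<delta>: "\<eta> t < 1 / C1" if "0 \<le> t" "t < \<delta>" for t
      using that eta_0 by (auto simp: dist_real_def abs_less_iff)
    have "mdist X (g u) (g v) \<le> (1 / \<delta>) * mdist X (g u) (g w)"
      if uvw: "u \<in> mspace Y" "v \<in> mspace Y" "w \<in> mspace Y" and le: "mdist Y u v \<le> C * mdist Y u w" for u v w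
    proof (cases "u = v")
      case True
      then show ?thesis
        using g uvw \<open>\<delta> > 0\<close> by simp
    next
      case False
      have guv: "g u \<noteq> g v"
        using g uvw False by metis
      have Y_pos: "0 < mdist Y u v" and X_pos: "0 < mdist X (g u) (g v)"
        using g uvw False guv by (auto simp: order_less_le)
      have "C * mdist Y u w \<le> C1 * mdist Y u w"
        by (intro mult_right_mono) (auto simp: C1_def)
      then have "mdist Y u v \<le> C1 * mdist Y u w"
        using le by linarith
      then have "1 / C1 \<le> mdist Y u w / mdist Y u v"
        using Y_pos \<open>1 / C1 > 0\<close> by (simp add: field_simps)
      also have "\<dots> \<le> \<eta> (mdist X (g u) (g w) / mdist X (g u) (g v))"
        using qs[of "g u" "g w" "g v"] g uvw guv by simp
      finally have "\<delta> \<le> mdist X (g u) (g w) / mdist X (g u) (g v)"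
        using \<delta>[of "mdist X (g u) (g w) / mdist X (g u) (g v)"] X_pos by force
      then show ?thesis
        using X_pos \<open>\<delta> > 0\<close> by (simp add: field_simps)
    qed
    then show "\<exists>C'. \<forall>x\<in>mspace Y. \<forall>y\<in>mspace Y. \<forall>z\<in>mspace Y. mdist Y x y \<le> C * mdist Y x z \<longrightarrow>
        mdist X (g x) (g y) \<le> C' * mdist X (g x) (g z)"
      by blast
  qed
  ultimately show ?thesis
    using that f g by blast
qed

lemma quasisymmetrically_equivalent_controls_ratios:
  assumes "quasisymmetrically_equivalent Z W"
  obtains f g where "\<And>x. x \<in> mspace Z \<Longrightarrow> f x \<in> mspace W \<and> g (f x) = x"
    "\<And>y. y \<in> mspace W \<Longrightarrow> g y \<in> mspace Z \<and> f (g y) = y"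
    "controls_ratios Z W f" "controls_ratios W Z g"
proof -
  consider f where "quasisymmetry Z W f" | g where "quasisymmetry W Z g"
    using assms unfolding quasisymmetrically_equivalent_def by blast
  then show ?thesis
  proof cases
    case (1 f)
    from quasisymmetry_controls_ratios[OF this] show ?thesis
      using that by metis
  next
    case (2 g)
    from quasisymmetry_controls_ratios[OF this] show ?thesis
      using that by metis
  qed
qed

section \<open>Quasisymmetric spaces have bilipschitz fillings\<close>

lemma hyperbolic_filling_nets:
  assumes "hyperbolic_filling Z V E"
  obtains c s P where "c > 0" "filling_nets (scaled_metric c Z) s P"
    "V = filling_vertices P" "E = filling_edges (scaled_metric c Z) s P"
  using assms unfolding hyperbolic_filling_def filling_nets_def
  by (metis mspace_scaled_metric)

theorem corollary1p3:
  fixes Z :: "'a metric" and W :: "'b metric"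
    and V\<^sub>X :: "(nat \<times> 'a) set" and E\<^sub>X :: "(nat \<times> 'a) set set"
    and V\<^sub>Y :: "(nat \<times> 'b) set" and E\<^sub>Y :: "(nat \<times> 'b) set set"
  assumes "compact_space (mtopology_of Z)" and "compact_space (mtopology_of W)"
    and "ahlfors_regular Z" and "ahlfors_regular W"
    and "quasisymmetrically_equivalent Z W"
    and "hyperbolic_filling Z V\<^sub>X E\<^sub>X" and "hyperbolic_filling W V\<^sub>Y E\<^sub>Y"
  shows "bilipschitz_equivalent (graph_metric V\<^sub>X E\<^sub>X) (graph_metric V\<^sub>Y E\<^sub>Y)"
proof -
  obtain c s P where X: "c > 0" "filling_nets (scaled_metric c Z) s P"
    "V\<^sub>X = filling_vertices P" "E\<^sub>X = filling_edges (scaled_metric c Z) s P"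
    using assms(6) by (rule hyperbolic_filling_nets)
  obtain c' s' P' where Y: "c' > 0" "filling_nets (scaled_metric c' W) s' P'"
    "V\<^sub>Y = filling_vertices P'" "E\<^sub>Y = filling_edges (scaled_metric c' W) s' P'"
    using assms(7) by (rule hyperbolic_filling_nets)
  obtain f g where to_W: "\<And>x. x \<in> mspace Z \<Longrightarrow> f x \<in> mspace W \<and> g (f x) = x"
    and to_Z: "\<And>y. y \<in> mspace W \<Longrightarrow> g y \<in> mspace Z \<and> f (g y) = y"
    and ratios: "controls_ratios Z W f" "controls_ratios W Z g"
    using assms(5) by (rule quasisymmetrically_equivalent_controls_ratios) (rule that)
  interpret filling_correspondence "scaled_metric c Z" s P "scaled_metric c' W" s' P' f g
    using X(1,2) Y(1,2) to_W to_Z ratios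
    by (simp add: filling_correspondence_def filling_correspondence_axioms_def controls_ratios_scaled)
  show ?thesis
    unfolding X(3,4) Y(3,4)
  proof (cases "\<exists>x\<in>mspace Z. \<exists>y\<in>mspace Z. x \<noteq> y")
    case True
    then obtain x y where Z: "x \<in> mspace Z" "y \<in> mspace Z" "x \<noteq> y"
      by blast
    then have W: "f x \<in> mspace W" "f y \<in> mspace W" "f x \<noteq> f y"
      using to_W by metis+
    show "bilipschitz_equivalent (graph_metric X.V X.E) (graph_metric Y.V Y.E)"
    proof (rule bilipschitz_fillings)
      show "uniformly_perfect (scaled_metric c Z)" "doubling (scaled_metric c Z)"
        using ahlfors_regular_uniformly_perfect[OF assms(3) Z]
          compact_ahlfors_regular_doubling[OF assms(1,3) Z] X(1)
        by (auto intro: uniformly_perfect_scaled doubling_scaled)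
      show "uniformly_perfect (scaled_metric c' W)" "doubling (scaled_metric c' W)"
        using ahlfors_regular_uniformly_perfect[OF assms(4) W]
          compact_ahlfors_regular_doubling[OF assms(2,4) W] Y(1)
        by (auto intro: uniformly_perfect_scaled doubling_scaled)
    qed
  next
    case False
    then show "bilipschitz_equivalent (graph_metric X.V X.E) (graph_metric Y.V Y.E)"
      using X(1) by (intro bilipschitz_fillings_of_point) auto
  qed
qed

end
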